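(* Let $(K,d)$, $(T,E,\emptyset)$, $\{K_w\}_{w\in T}$, $\mu$ and $M_*\ge1$ satisfy assumptions (i)--(iii) stated in the context, let $\mathcal I$ be a covering system with covering numbers $(N_T,N_E)$, and let $p\in(1,\infty)$. Suppose there are constants $c>0$ and $0<\sigma\le1$ such that $$\mathcal E_{p,m}\big(\{w\},\,T_{|w|}\setminus\Gamma_{M_*}(w),\,T_{|w|}\big)\le c\,\sigma^{-m}\quad\text{for all } m\ge0,\ w\in T,$$ $$\sigma_{p,m,n}\le c\,\sigma^m\quad\text{for all } m\ge0,\ n\ge1.$$ Then there is an unbounded $f\in L^p(K,\mu)\setminus C(K)$ such that $$\sup_{n\ge1}\sigma^n\,\mathcal E^n_p(P_nf)<\infty.$$
   Context: **Trees.** $T$ is a countably infinite set and $E\subset T\times T\setminus\{(w,w):w\in T\}$ is symmetric. $(T,E)$ is a tree if for any two distinct $w,v\in T$ there is a unique simple path from $w$ to $v$. It is assumed locally finite (every vertex has finitely many neighbours) with no leaves (every vertex has at least two neighbours). A reference point $\emptyset\in T$ is fixed. Define $\pi(\emptyset)=\emptyset$ and, for $w\ne\emptyset$, let $\pi(w)$ be the vertex preceding $w$ on the simple path from $\emptyset$ to $w$. Put $S(w)=\{v\in T:\pi(v)=w\}\setminus\{w\}$, $S^0(w)=\{w\}$, $S^1(w)=S(w)$, $S^k(w)=\bigcup_{v\in S(w)}S^{k-1}(v)$ for $k\ge2$, and $S^m(A)=\bigcup_{w\in A}S^m(w)$ for $A\subset T$. Let $|w|=\min\{n\ge0:\pi^n(w)=\emptyset\}$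 and $T_n=\{w\in T:|w|=n\}$. **Partition.** A family $\{K_w\}_{w\in T}$ of nonempty compact subsets of a compact connected metric space $(K,d)$ is a partition of $(K,d)$ parameterized by $(T,E,\emptyset)$ if: (P1) $K_\emptyset=K$, and for each $w\in T$ the set $K_w$ is connected and $K_w=\bigcup_{v\in S(w)}K_v$; (P2) for every sequence $(\omega(i))_{i\ge0}$ in $T$ with $\omega(0)=\emptyset$ and $\omega(i)=\pi(\omega(i+1))$, $\omega(i)\in T_i$ for all $i\ge 0$, the set $\bigcap_{i\ge0}K_{\omega(i)}$ is a single point. For $M\ge1$ and $w\in T$, $\Gamma_M(w)$ is the set of $v\in T_{|w|}$ for which there are $k\le M$ and $w_0,\dots,w_k\in T_{|w|}$ with $w_0=w$, $w_k=v$ and $K_{w_i}\cap K_{w_{i+1}}\ne\emptyset$ for $0\le i\le k-1$. **Assumptions.** $(K,d)$ is a compact connected metric space with $\operatorname{diam}(K,d)=1$, and $\{K_w\}_{w\in T}$ is a partition of $(K,d)$ parameterized by $(T,E,\emptyset)$ such that: (i) there is $L_*\in(0,\infty)$ with $\#\{v\in T_n\setminus\{w\}:K_w\cap K_v\ne\emptyset\}\le L_*$ for all $n\ge0$ and $w\in T_n$; (ii) there is $M_*\ge1$ (an integer) with $\pi(\Gamma_{M_*+1}(w))\subset\Gamma_{M_*}(\pi(w))$ for all $w\in T$; (iii) $\mu$ is a Borel regular probability measure on $(K,d)$ with $0<\mu(K_w)=\sum_{v\in S(w)}\mu(K_v)$ for each $w\in T$, and there are $c_\mu\in(0,\infty)$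 and $\gamma\in(0,1)$ with $\mu(K_w)\le c_\mu\gamma^{|w|}$ for each $w\in T$. **Covering systems.** For $A\subset T_n$, a finite family $\{G_i\}_{i=1}^k$ of subsets of $T_n$ is a covering of $A$ with covering numbers $(N_T,N_E)$ if $A=\bigcup_iG_i$, $\max_{w\in A}\#\{i:w\in G_i\}\le N_T$, and for any $u,v\in A$ with $K_u\cap K_v\ne\emptyset$ there are $l\le N_E$ and $w_1,\dots,w_{l+1}\in A$ with $w_1=u$, $w_{l+1}=v$ such that for every $1\le j\le l$ one has $K_{w_j}\cap K_{w_{j+1}}\ne\emptyset$ and $\{w_j,w_{j+1}\}\subset G_i$ for some $i$. A collection $\mathcal I\subset\bigcup_{n\ge0}\{A:A\subset T_n\}$ is a covering system with covering numbers $(N_T,N_E)$ if $\sup_{A\in\mathcal I}\#A<\infty$; for any $w\in T$, $m\ge1$ some finite subset of $\mathcal I$ is a covering of $S^m(w)$ with covering numbers $(N_T,N_E)$; and for any $G\in\mathcal I$ and $m\ge 1$ some finite subset of $\mathcal I$ is a covering of $S^m(G)$ with covering numbers $(N_T,N_E)$. **Energies and constants.** For $f\in L^1(K,\mu)$ and $w\in T_n$ put $P_nf(w)=\mu(K_w)^{-1}\int_{K_w}f\,d\mu$. For $n\ge 0$, $A\subset T_n$ and $f:A\to\mathbb R$ put $\mathcal E^n_{p,A}(f)=\frac12\sum_{w,v\in A,\,K_w\cap K_v\ne\emptyset}|f(w)-f(v)|^p$, and $\mathcal E^n_p=\mathcal E^n_{p,T_n}$. For $n,m\ge0$ and disjoint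 $A_1,A_2\subset T_n$, $$\mathcal E_{p,m}(A_1,A_2,T_n)=\inf\{\mathcal E^{n+m}_p(f): f:T_{n+m}\to\mathbb R,\ f|_{S^m(A_1)}=1,\ f|_{S^m(A_2)}=0\}.$$ For $n\ge1$, $m\ge0$, $A\subset T_n$, $$\sigma_{p,m}(A)=\sup_{f\in L^1(K,\mu)}\frac{\mathcal E^n_{p,A}((P_nf)|_A)}{\mathcal E^{n+m}_{p,S^m(A)}((P_{n+m}f)|_{S^m(A)})}$$ (with $0/0=0$ and $a/0=\infty$ for $a>0$), and $\sigma_{p,m,n}=\max_{A\in\mathcal I,\,A\subset T_n}\sigma_{p,m}(A)$. **Convention.** Elements of $L^p(K,\mu)$ are $\mu$-a.e. equivalence classes: "$f$ is unbounded" means $f$ is not $\mu$-essentially bounded, and $f\notin C(K)$ means that $f$ does not coincide $\mu$-a.e. with a continuous function on $K$. *)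

theory Defs
  imports "HOL-Probability.Probability"
begin

section \<open>Rooted trees\<close>

record 't rooted_graph =
  verts :: "'t set"
  edges :: "('t \<times> 't) set"
  base :: 't

definition simple_graph_path :: "'t rooted_graph \<Rightarrow> 't \<Rightarrow> 't list \<Rightarrow> 't \<Rightarrow> bool" where
  "simple_graph_path G w xs v \<longleftrightarrow>
     xs \<noteq> [] \<and> hd xs = w \<and> last xs = v \<and> set xs \<subseteq> verts G \<and> distinct xs \<and>
     successively (\<lambda>x y. (x, y) \<in> edges G) xs"

definition infinite_tree :: "'t rooted_graph \<Rightarrow> bool" where
  "infinite_tree G \<longleftrightarrow>
     countable (verts G) \<and> infinite (verts G) \<and> base G \<in> verts G \<and>
     edges G \<subseteq> verts G \<times> verts G - Id \<and> sym (edges G) \<and>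
     (\<forall>w\<in>verts G. \<forall>v\<in>verts G. w \<noteq> v \<longrightarrow> (\<exists>!xs. simple_graph_path G w xs v))"

definition locally_finite_graph :: "'t rooted_graph \<Rightarrow> bool" where
  "locally_finite_graph G \<longleftrightarrow> (\<forall>w\<in>verts G. finite {v. (w, v) \<in> edges G})"

definition leafless :: "'t rooted_graph \<Rightarrow> bool" where
  "leafless G \<longleftrightarrow>
     (\<forall>w\<in>verts G. \<exists>u v. u \<noteq> v \<and> (w, u) \<in> edges G \<and> (w, v) \<in> edges G)"

definition parent :: "'t rooted_graph \<Rightarrow> 't \<Rightarrow> 't" where
  "parent G w =
     (if w = base G then base G else last (butlast (THE xs. simple_graph_path G (base G) xs w)))"

definition children :: "'t rooted_graph \<Rightarrow> 't \<Rightarrow> 't set" where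
  "children G w = {v \<in> verts G. parent G v = w} - {w}"

primrec descendants :: "'t rooted_graph \<Rightarrow> nat \<Rightarrow> 't \<Rightarrow> 't set" where
  "descendants G 0 w = {w}"
| "descendants G (Suc k) w = (\<Union>v\<in>children G w. descendants G k v)"

definition descendants_of :: "'t rooted_graph \<Rightarrow> nat \<Rightarrow> 't set \<Rightarrow> 't set" where
  "descendants_of G m A = (\<Union>w\<in>A. descendants G m w)"

definition depth :: "'t rooted_graph \<Rightarrow> 't \<Rightarrow> nat" where
  "depth G w = (LEAST n. (parent G ^^ n) w = base G)"

definition level :: "'t rooted_graph \<Rightarrow> nat \<Rightarrow> 't set" where
  "level G n = {w \<in> verts G. depth G w = n}"


section \<open>Partitions of a compact metric space\<close>

definition tree_partition ::
  "'t rooted_graph \<Rightarrow> 'a::metric_space set \<Rightarrow> ('t \<Rightarrow> 'a set) \<Rightarrow> bool" where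
  "tree_partition G K cell \<longleftrightarrow>
     (\<forall>w\<in>verts G. cell w \<noteq> {} \<and> compact (cell w) \<and> cell w \<subseteq> K) \<and>
     cell (base G) = K \<and>
     (\<forall>w\<in>verts G. connected (cell w) \<and> cell w = (\<Union>v\<in>children G w. cell v)) \<and>
     (\<forall>\<omega> :: nat \<Rightarrow> 't.
        \<omega> 0 = base G \<and> (\<forall>i. \<omega> i = parent G (\<omega> (Suc i))) \<and> (\<forall>i. \<omega> i \<in> level G i)
        \<longrightarrow> (\<exists>x. (\<Inter>i. cell (\<omega> i)) = {x}))"

abbreviation touching :: "('t \<Rightarrow> 'a set) \<Rightarrow> 't \<Rightarrow> 't \<Rightarrow> bool" where
  "touching cell w v \<equiv> cell w \<inter> cell v \<noteq> {}"

definition neighborhood ::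
  "'t rooted_graph \<Rightarrow> ('t \<Rightarrow> 'a set) \<Rightarrow> nat \<Rightarrow> 't \<Rightarrow> 't set" where
  "neighborhood G cell M w =
     {v \<in> level G (depth G w). \<exists>k\<le>M. \<exists>ws :: nat \<Rightarrow> 't.
        (\<forall>i\<le>k. ws i \<in> level G (depth G w)) \<and> ws 0 = w \<and> ws k = v \<and>
        (\<forall>i<k. touching cell (ws i) (ws (Suc i)))}"

text \<open>The measure may live on a sigma-algebra larger than the Borel one (for instance its
  completion), as long as every measurable set has a Borel hull of the same measure.\<close>

definition borel_regular_on :: "'a::metric_space set \<Rightarrow> 'a measure \<Rightarrow> bool" where
  "borel_regular_on K \<mu> \<longleftrightarrow>
     space \<mu> = K \<and> sets (restrict_space borel K) \<subseteq> sets \<mu> \<and>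
     (\<forall>A\<in>sets \<mu>. \<exists>B\<in>sets (restrict_space borel K). A \<subseteq> B \<and> emeasure \<mu> B = emeasure \<mu> A)"


section \<open>Covering systems\<close>

definition is_covering ::
  "'t rooted_graph \<Rightarrow> ('t \<Rightarrow> 'a set) \<Rightarrow> nat \<Rightarrow> nat \<Rightarrow> 't set \<Rightarrow> 'i set \<Rightarrow> ('i \<Rightarrow> 't set) \<Rightarrow> bool"
  where
  "is_covering G cell N\<^sub>T N\<^sub>E A I F \<longleftrightarrow>
     finite I \<and> (\<exists>n. A \<subseteq> level G n \<and> (\<forall>i\<in>I. F i \<subseteq> level G n)) \<and>
     A = (\<Union>i\<in>I. F i) \<and>
     (\<forall>w\<in>A. card {i \<in> I. w \<in> F i} \<le> N\<^sub>T) \<and>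
     (\<forall>u\<in>A. \<forall>v\<in>A. touching cell u v \<longrightarrow>
        (\<exists>l\<le>N\<^sub>E. \<exists>ws :: nat \<Rightarrow> 't.
           (\<forall>j\<in>{1..l + 1}. ws j \<in> A) \<and> ws 1 = u \<and> ws (l + 1) = v \<and>
           (\<forall>j\<in>{1..l}. touching cell (ws j) (ws (j + 1)) \<and>
              (\<exists>i\<in>I. {ws j, ws (j + 1)} \<subseteq> F i))))"

text \<open>A finite subset of a collection is regarded as a family indexed by itself.\<close>

definition covering_system ::
  "'t rooted_graph \<Rightarrow> ('t \<Rightarrow> 'a set) \<Rightarrow> nat \<Rightarrow> nat \<Rightarrow> 't set set \<Rightarrow> bool" where
  "covering_system G cell N\<^sub>T N\<^sub>E \<I> \<longleftrightarrow>
     \<I> \<subseteq> (\<Union>n. Pow (level G n)) \<and>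
     (\<exists>B. \<forall>A\<in>\<I>. finite A \<and> card A \<le> B) \<and>
     (\<forall>w\<in>verts G. \<forall>m\<ge>1. \<exists>\<G>\<subseteq>\<I>. finite \<G> \<and>
        is_covering G cell N\<^sub>T N\<^sub>E (descendants G m w) \<G> (\<lambda>X. X)) \<and>
     (\<forall>A\<in>\<I>. \<forall>m\<ge>1. \<exists>\<G>\<subseteq>\<I>. finite \<G> \<and>
        is_covering G cell N\<^sub>T N\<^sub>E (descendants_of G m A) \<G> (\<lambda>X. X))"


section \<open>Discrete energies and the associated constants\<close>

text \<open>The level of \<open>w\<close> is determined by \<open>w\<close>, so the projections \<open>P\<^sub>n\<close> to the various levels are
  the restrictions of a single function on the tree; likewise for the energies below.\<close>

definition cell_average :: "'a measure \<Rightarrow> ('t \<Rightarrow> 'a set) \<Rightarrow> ('a \<Rightarrow> real) \<Rightarrow> 't \<Rightarrow> real" where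
  "cell_average \<mu> cell f w = (LINT x:cell w|\<mu>. f x) / measure \<mu> (cell w)"

definition energy :: "('t \<Rightarrow> 'a set) \<Rightarrow> real \<Rightarrow> 't set \<Rightarrow> ('t \<Rightarrow> real) \<Rightarrow> real" where
  "energy cell p A f =
     1 / 2 * (\<Sum>(w, v)\<in>{(w, v). w \<in> A \<and> v \<in> A \<and> touching cell w v}. \<bar>f w - f v\<bar> powr p)"

text \<open>For disjoint subsets \<open>A\<^sub>1\<close>, \<open>A\<^sub>2\<close> of level \<open>n\<close> there are admissible functions, so that the
  infimum below is over a nonempty set of nonnegative numbers.\<close>

definition conductance ::
  "'t rooted_graph \<Rightarrow> ('t \<Rightarrow> 'a set) \<Rightarrow> real \<Rightarrow> nat \<Rightarrow> nat \<Rightarrow> 't set \<Rightarrow> 't set \<Rightarrow> real" where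
  "conductance G cell p m n A\<^sub>1 A\<^sub>2 =
     Inf {energy cell p (level G (n + m)) f | f.
        (\<forall>v\<in>descendants_of G m A\<^sub>1. f v = 1) \<and> (\<forall>v\<in>descendants_of G m A\<^sub>2. f v = 0)}"

text \<open>Division in \<^typ>\<open>ennreal\<close> satisfies \<open>0 / 0 = 0\<close> and \<open>a / 0 = \<infinity>\<close> for \<open>a > 0\<close>.\<close>

definition neighbor_disparity ::
  "'t rooted_graph \<Rightarrow> ('t \<Rightarrow> 'a set) \<Rightarrow> 'a measure \<Rightarrow> real \<Rightarrow> nat \<Rightarrow> 't set \<Rightarrow> ennreal" where
  "neighbor_disparity G cell \<mu> p m A =
     (SUP f\<in>{f :: 'a \<Rightarrow> real. integrable \<mu> f}.
        ennreal (energy cell p A (cell_average \<mu> cell f)) /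
        ennreal (energy cell p (descendants_of G m A) (cell_average \<mu> cell f)))"

text \<open>Levels are finite, and for a covering system some member is contained in level \<open>n\<close> if
  \<open>n \<ge> 1\<close>; hence the supremum is a maximum.\<close>

definition neighbor_disparity_const ::
  "'t rooted_graph \<Rightarrow> ('t \<Rightarrow> 'a set) \<Rightarrow> 'a measure \<Rightarrow> 't set set \<Rightarrow> real \<Rightarrow> nat \<Rightarrow> nat \<Rightarrow> ennreal"
  where
  "neighbor_disparity_const G cell \<mu> \<I> p m n =
     (SUP A\<in>{A \<in> \<I>. A \<subseteq> level G n}. neighbor_disparity G cell \<mu> p m A)"


section \<open>Properties of functions up to null sets\<close>

definition in_Lp :: "real \<Rightarrow> 'a measure \<Rightarrow> ('a \<Rightarrow> real) \<Rightarrow> bool" where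
  "in_Lp p \<mu> f \<longleftrightarrow> f \<in> borel_measurable \<mu> \<and> integrable \<mu> (\<lambda>x. \<bar>f x\<bar> powr p)"

definition ess_bounded :: "'a measure \<Rightarrow> ('a \<Rightarrow> real) \<Rightarrow> bool" where
  "ess_bounded \<mu> f \<longleftrightarrow> (\<exists>C. AE x in \<mu>. \<bar>f x\<bar> \<le> C)"

definition ae_continuous :: "'a::metric_space set \<Rightarrow> 'a measure \<Rightarrow> ('a \<Rightarrow> real) \<Rightarrow> bool" where
  "ae_continuous K \<mu> f \<longleftrightarrow> (\<exists>g. continuous_on K g \<and> (AE x in \<mu>. f x = g x))"

end

theory Submission
  imports Defs "HOL-Library.Diagonal_Subsequence" "HOL-Real_Asymp.Real_Asymp"
begin

text \<open>
  The function is a logarithmic singularity at the end of a ray \<open>w\<^sub>0, w\<^sub>1, \<dots>\<close> of the tree, where \<open>w\<^sub>k\<close>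
  has depth \<open>k (M + 1)\<close>: up to discretisation it is \<open>\<Sum>\<^sub>k h\<^sub>k / (k + 1)\<close>, where \<open>h\<^sub>k\<close> is a near-optimal
  cutoff function for the conductance around \<open>w\<^sub>k\<close>. By the condition relating \<open>M + 1\<close>-neighborhoods
  to \<open>M\<close>-neighborhoods of parents, the gradients of the \<open>h\<^sub>k\<close> have disjoint supports, so the energies
  add up with the weights \<open>(k + 1) powr - p\<close>, which are summable since \<open>p > 1\<close>, whereas the
  values on the cell of \<open>w\<^sub>k\<close> are at least the harmonic sum of the first \<open>k + 1\<close> weights.

  Only the discretisations \<open>F\<^sub>N\<close> on the levels \<open>N\<close> are available. The disparity bound and the covering
  system control the energy of the averages of \<open>F\<^sub>N\<close> on all coarser levels, uniformly in \<open>N\<close>; a diagonal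
  subsequence of these averages converges to a martingale along the tree. It is bounded in \<open>L\<^sup>2\<close> and
  \<open>L\<^sup>p\<close> because the supports shrink geometrically, so it is the family of cell averages of a function.
\<close>

section \<open>Ancestors and levels\<close>

text \<open>The spacing \<open>M + 1\<close> is forced as follows. The parent condition shrinks
  neighborhoods by one unit of radius per generation, but says nothing below radius
  \<open>M\<close>. A cutoff must therefore be 1 on the whole \<open>M\<close>-neighborhood of its
  vertex, whereas the conductance bound provides the value 1 only below the vertex itself. Adding
  the cutoffs of all vertices of the neighborhood repairs this and widens the support to radius
  \<open>2 * M\<close>. Cells touching the support lie within radius \<open>2 * M + 1\<close>, and
  \<open>M + 1\<close> generations bring this down to \<open>M\<close>, where the preceding cutoff
  is constant.

  A cutoff around a vertex of level n, discretised on level N, costs about \<sigma>^(n - N).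
  Normalised by \<sigma>^N this is \<sigma>^n \<le> 1, uniformly in N, but without decay in n if
  \<sigma> = 1; this is why the weights alone have to make the sum finite.

  The cutoffs for different N are chosen independently, so there is no relation between F_N and
  F_(N+1) and nothing to take a pointwise limit of. Their averages at one fixed vertex are real
  numbers bounded in N, and the upper bounds on energies as well as the lower bounds along the ray
  are closed conditions on finitely many of these.\<close>

locale rooted_tree =
  fixes G :: "'t rooted_graph"
  assumes infinite_tree: "infinite_tree G"
    and locally_finite: "locally_finite_graph G"
begin

lemma base_in_verts [simp]: "base G \<in> verts G"
  using infinite_tree by (simp add: infinite_tree_def)

lemma parent_base [simp]: "parent G (base G) = base G"
  by (simp add: parent_def)

lemma ancestor_base [simp]: "(parent G ^^ n) (base G) = base G"
  by (induction n) auto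

text \<open>Uniqueness of simple paths evaluates the definite description in \<open>parent\<close>
  to \<open>xs\<close>. Dropping the last vertex then gives the path to the parent, so induction on
  path length is induction along ancestors.\<close>

lemma parent_path:
  assumes path: "simple_graph_path G (base G) xs w" and w: "w \<noteq> base G"
  shows "simple_graph_path G (base G) (butlast xs) (parent G w)"
    and "(parent G w, w) \<in> edges G"
    and "parent G w \<in> verts G"
proof -
  have "w \<in> verts G" using path by (auto simp: simple_graph_path_def)
  then have "\<exists>!xs. simple_graph_path G (base G) xs w"
    using infinite_tree w by (simp add: infinite_tree_def)
  then have "(THE xs. simple_graph_path G (base G) xs w) = xs"
    using path by blast
  then have par: "parent G w = last (butlast xs)"
    using w by (simp add: parent_def)
  define ys where "ys = butlast xs"
  have xs: "xs = ys @ [w]"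
    using path by (auto simp: simple_graph_path_def ys_def)
  have ys: "ys \<noteq> []" "hd ys = base G"
    using path w xs by (cases ys; auto simp: simple_graph_path_def)+
  show "simple_graph_path G (base G) (butlast xs) (parent G w)"
    using path ys unfolding par simple_graph_path_def xs
    by (auto simp: successively_append_iff)
  show "(parent G w, w) \<in> edges G"
    using path ys unfolding par simple_graph_path_def xs
    by (auto simp: successively_append_iff)
  show "parent G w \<in> verts G"
    using path ys unfolding par simple_graph_path_def xs
    by auto
qed

lemma path_from_base:
  assumes "w \<in> verts G"
  obtains xs where "simple_graph_path G (base G) xs w"
proof (cases "w = base G")
  case True
  then have "simple_graph_path G (base G) [base G] w"
    by (simp add: simple_graph_path_def)
  then show ?thesis using that by blast
next
  case False
  then show ?thesis
    using infinite_tree assms that by (metis infinite_tree_def)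
qed

lemma parent_edge: "w \<in> verts G \<Longrightarrow> w \<noteq> base G \<Longrightarrow> (parent G w, w) \<in> edges G"
  by (metis path_from_base parent_path(2))

lemma parent_in_verts [simp]: "w \<in> verts G \<Longrightarrow> parent G w \<in> verts G"
  by (metis path_from_base parent_path(3) parent_base)

lemma ancestor_in_verts: "w \<in> verts G \<Longrightarrow> (parent G ^^ n) w \<in> verts G"
  by (induction n) auto

lemma ancestor_eq_base:
  assumes "w \<in> verts G"
  shows "\<exists>n. (parent G ^^ n) w = base G"
proof -
  have "\<exists>n. (parent G ^^ n) w = base G" if "simple_graph_path G (base G) xs w" for xs w
    using that
  proof (induction "length xs" arbitrary: xs w rule: less_induct)
    case less
    show ?case
    proof (cases "w = base G")
      case True
      then show ?thesis by (intro exI[of _ 0]) simp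
    next
      case False
      have "xs \<noteq> []" using less.prems by (simp add: simple_graph_path_def)
      then have "length (butlast xs) < length xs" by simp
      then obtain n where "(parent G ^^ n) (parent G w) = base G"
        using less.hyps parent_path(1)[OF less.prems False] by blast
      then show ?thesis by (intro exI[of _ "Suc n"]) (simp add: funpow_swap1)
    qed
  qed
  then show ?thesis using assms path_from_base by metis
qed

lemma depth_base [simp]: "depth G (base G) = 0"
  by (simp add: depth_def Least_equality)

lemma depth_eq_Suc:
  assumes "w \<in> verts G" "w \<noteq> base G"
  shows "depth G w = Suc (depth G (parent G w))"
proof -
  obtain n where "(parent G ^^ n) w = base G"
    using ancestor_eq_base[OF assms(1)] by blast
  then show ?thesis
    unfolding depth_def using assms(2) by (subst Least_Suc) (auto simp: funpow_swap1)
qed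

lemma level_0: "level G 0 = {base G}"
  by (auto simp: level_def) (metis depth_eq_Suc nat.distinct(1))

lemma level_Suc_iff: "v \<in> level G (Suc n) \<longleftrightarrow> v \<in> verts G \<and> v \<noteq> base G \<and> parent G v \<in> level G n"
  using depth_eq_Suc[of v] by (cases "v = base G") (auto simp: level_def)

lemma parent_neq: "w \<in> verts G \<Longrightarrow> w \<noteq> base G \<Longrightarrow> parent G w \<noteq> w"
  by (metis depth_eq_Suc n_not_Suc_n)

lemma in_level_depth: "w \<in> verts G \<Longrightarrow> w \<in> level G (depth G w)"
  by (simp add: level_def)

lemma level_verts: "w \<in> level G n \<Longrightarrow> w \<in> verts G"
  by (simp add: level_def)

lemma level_depth: "w \<in> level G n \<Longrightarrow> depth G w = n"
  by (simp add: level_def)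

lemma ancestor_level: "w \<in> level G (n + m) \<Longrightarrow> (parent G ^^ m) w \<in> level G n"
  by (induction m arbitrary: w) (auto simp: funpow_swap1 level_Suc_iff)

lemma children_eq: "w \<in> level G n \<Longrightarrow> children G w = {v \<in> level G (Suc n). parent G v = w}"
  unfolding children_def level_Suc_iff
  using parent_neq[of w] by (auto dest: level_verts)

lemma finite_children: "w \<in> verts G \<Longrightarrow> finite (children G w)"
proof -
  assume w: "w \<in> verts G"
  have "children G w \<subseteq> {v. (w, v) \<in> edges G}"
  proof
    fix v assume "v \<in> children G w"
    then have "v \<in> verts G" "v \<noteq> base G" "parent G v = w" by (auto simp: children_def)
    then show "v \<in> {v. (w, v) \<in> edges G}" using parent_edge by blast
  qed
  then show ?thesis
    using locally_finite w finite_subset by (auto simp: locally_finite_graph_def)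
qed

text \<open>Generations defined downwards become fibres of the iterated parent map; in this form
  they are visibly disjoint for distinct vertices of one level.\<close>

lemma descendants_eq:
  "w \<in> level G n \<Longrightarrow> descendants G m w = {v \<in> level G (n + m). (parent G ^^ m) v = w}"
proof (induction m arbitrary: w n)
  case 0
  then show ?case by auto
next
  case (Suc m)
  have "descendants G m v = {u \<in> level G (n + Suc m). (parent G ^^ m) u = v}"
    if "v \<in> children G w" for v
    using Suc.IH[of v "Suc n"] that children_eq[OF Suc.prems] by simp
  then show ?case
    using ancestor_level[of _ "Suc n" m] by (auto simp: children_eq[OF Suc.prems])
qed

lemma descendants_subset_level: "w \<in> level G n \<Longrightarrow> descendants G m w \<subseteq> level G (n + m)"
  by (auto simp: descendants_eq)

lemma finite_descendants: "w \<in> verts G \<Longrightarrow> finite (descendants G m w)"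
proof (induction m arbitrary: w)
  case (Suc m)
  then show ?case
    by (auto simp: finite_children) (simp add: children_def)
qed simp

lemma level_eq_descendants: "level G n = descendants G n (base G)"
  using ancestor_level[of _ 0 n] by (auto simp: descendants_eq[of "base G" 0] level_0)

lemma finite_level: "finite (level G n)"
  by (simp add: level_eq_descendants finite_descendants)

lemma descendants_of_eq:
  "A \<subseteq> level G n \<Longrightarrow> descendants_of G m A = {v \<in> level G (n + m). (parent G ^^ m) v \<in> A}"
  
  unfolding descendants_of_def by (subst SUP_cong[OF refl descendants_eq]) auto

end

section \<open>Cells and neighborhoods\<close>

text \<open>The count includes \<open>w\<close> itself, unlike that in assumption (i), so that balls
  of radius \<open>M\<close> have at most \<open>L ^ M\<close> elements without correction
  terms.\<close>

locale tree_cells = rooted_tree G for G :: "'t rooted_graph" +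
  fixes K :: "'a::metric_space set" and cell :: "'t \<Rightarrow> 'a set" and L :: nat
  assumes partition: "tree_partition G K cell"
    and overlap: "w \<in> level G n \<Longrightarrow> card {v \<in> level G n. touching cell w v} \<le> L"
begin

lemmas partition_unfolded = partition[unfolded tree_partition_def]

lemma cell_nonempty: "w \<in> verts G \<Longrightarrow> cell w \<noteq> {}"
  and compact_cell: "w \<in> verts G \<Longrightarrow> compact (cell w)"
  and cell_subset: "w \<in> verts G \<Longrightarrow> cell w \<subseteq> K"
  using partition_unfolded[THEN conjunct1] by blast+

lemma cell_base [simp]: "cell (base G) = K"
  using partition_unfolded by (elim conjE)

lemma cell_eq_children: "w \<in> verts G \<Longrightarrow> cell w = (\<Union>v\<in>children G w. cell v)"
  using partition_unfolded[THEN conjunct2, THEN conjunct2, THEN conjunct1] by blast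

lemma touching_self: "w \<in> verts G \<Longrightarrow> touching cell w w"
  using cell_nonempty by simp

lemma touching_sym: "touching cell u v \<Longrightarrow> touching cell v u"
  by (simp add: Int_commute)

lemma children_nonempty: "w \<in> verts G \<Longrightarrow> children G w \<noteq> {}"
  using cell_eq_children[of w] cell_nonempty[of w] by auto

lemma cell_parent: "v \<in> verts G \<Longrightarrow> cell v \<subseteq> cell (parent G v)"
proof (cases "v = base G")
  case False
  assume v: "v \<in> verts G"
  then have "v \<in> children G (parent G v)"
    using False parent_neq[of v] by (auto simp: children_def)
  then show ?thesis using cell_eq_children[of "parent G v"] v by auto
qed simp

lemma cell_ancestor: "v \<in> verts G \<Longrightarrow> cell v \<subseteq> cell ((parent G ^^ m) v)"
proof (induction m)
  case (Suc m)
  then show ?case using cell_parent[of "(parent G ^^ m) v"] ancestor_in_verts[of v m] by auto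
qed simp

lemma touching_ancestor:
  assumes "u \<in> verts G" "v \<in> verts G" "touching cell u v"
  shows "touching cell ((parent G ^^ m) u) ((parent G ^^ m) v)"
  using assms cell_ancestor[of u m] cell_ancestor[of v m] by blast

lemma touching_parent:
  assumes "u \<in> verts G" "v \<in> verts G" "touching cell u v"
  shows "touching cell (parent G u) (parent G v)"
  using touching_ancestor[OF assms, of 1] by simp

lemma cell_eq_descendants: "w \<in> verts G \<Longrightarrow> cell w = (\<Union>v\<in>descendants G m w. cell v)"
proof (induction m arbitrary: w)
  case (Suc m)
  have "cell v = (\<Union>u\<in>descendants G m v. cell u)" if "v \<in> children G w" for v
    using Suc.IH that by (simp add: children_def)
  then show ?case using cell_eq_children[OF Suc.prems] by simp
qed simp

lemma neighborhood_0: "w \<in> verts G \<Longrightarrow> neighborhood G cell 0 w = {w}"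
  by (auto simp: neighborhood_def in_level_depth intro: exI[of _ "\<lambda>_. w"])

lemma neighborhood_level:
  assumes "w \<in> level G n" "v \<in> neighborhood G cell M w"
  shows "v \<in> level G n"
  using assms by (simp add: neighborhood_def level_depth)

text \<open>Replaces chains by a recursion on the radius, on which the later inductions rest. A
  chain shorter than allowed can be extended by repeating its end, since every cell touches
  itself.\<close>

lemma neighborhood_Suc:
  assumes w: "w \<in> level G n"
  shows "neighborhood G cell (Suc M) w =
    {v \<in> level G n. \<exists>u\<in>neighborhood G cell M w. touching cell u v}"
proof (intro subset_antisym subsetI)
  fix v assume "v \<in> neighborhood G cell (Suc M) w"
  then obtain k ws where v: "v \<in> level G n" and k: "k \<le> Suc M"
    and ws: "\<forall>i\<le>k. ws i \<in> level G n" "ws 0 = w" "ws k = v"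
      "\<forall>i<k. touching cell (ws i) (ws (Suc i))"
    unfolding neighborhood_def level_depth[OF w] by blast
  show "v \<in> {v \<in> level G n. \<exists>u\<in>neighborhood G cell M w. touching cell u v}"
  proof (cases "k \<le> M")
    case True
    then have "v \<in> neighborhood G cell M w"
      unfolding neighborhood_def level_depth[OF w] using v ws by blast
    then show ?thesis using v touching_self[OF level_verts[OF v]] by blast
  next
    case False
    with k have k: "k = Suc M" by simp
    have "ws M \<in> neighborhood G cell M w"
      unfolding neighborhood_def level_depth[OF w] using ws k
      by (intro CollectI conjI exI[of _ M] exI[of _ ws]) auto
    then show ?thesis using v ws k by blast
  qed
next
  fix v assume "v \<in> {v \<in> level G n. \<exists>u\<in>neighborhood G cell M w. touching cell u v}"
  then obtain u where v: "v \<in> level G n" and u: "u \<in> neighborhood G cell M w"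
    and uv: "touching cell u v" by blast
  from u obtain k ws where k: "k \<le> M"
    and ws: "\<forall>i\<le>k. ws i \<in> level G n" "ws 0 = w" "ws k = u"
      "\<forall>i<k. touching cell (ws i) (ws (Suc i))"
    unfolding neighborhood_def level_depth[OF w] by blast
  have "\<forall>i<Suc k. touching cell ((ws(Suc k := v)) i) ((ws(Suc k := v)) (Suc i))"
    using ws uv by (auto simp: less_Suc_eq)
  then show "v \<in> neighborhood G cell (Suc M) w"
    unfolding neighborhood_def level_depth[OF w] using v k ws
    by (intro CollectI conjI exI[of _ "Suc k"] exI[of _ "ws(Suc k := v)"]) auto
qed

lemma neighborhood_mono:
  assumes "w \<in> verts G" "a \<le> b"
  shows "neighborhood G cell a w \<subseteq> neighborhood G cell b w"
proof (rule lift_Suc_mono_le[OF _ assms(2)])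
  fix M
  show "neighborhood G cell M w \<subseteq> neighborhood G cell (Suc M) w"
    unfolding neighborhood_Suc[OF in_level_depth[OF assms(1)]]
    using neighborhood_level[OF in_level_depth[OF assms(1)]] touching_self[OF level_verts] by blast
qed

lemma neighborhood_self: "w \<in> verts G \<Longrightarrow> w \<in> neighborhood G cell M w"
  using neighborhood_mono[of w 0 M] by (simp add: neighborhood_0)

lemma finite_neighborhood: "finite (neighborhood G cell M w)"
  by (rule finite_subset[OF _ finite_level[of "depth G w"]]) (auto simp: neighborhood_def)

lemma card_neighborhood:
  assumes "w \<in> level G n"
  shows "card (neighborhood G cell M w) \<le> L ^ M"
proof (induction M)
  case 0
  then show ?case using assms by (simp add: neighborhood_0 level_verts)
next
  case (Suc M)
  have "neighborhood G cell (Suc M) w =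
      (\<Union>u\<in>neighborhood G cell M w. {v \<in> level G n. touching cell u v})"
    using neighborhood_Suc[OF assms] by auto
  also have "card \<dots> \<le> (\<Sum>u\<in>neighborhood G cell M w. card {v \<in> level G n. touching cell u v})"
    by (intro card_UN_le finite_neighborhood)
  also have "\<dots> \<le> (\<Sum>u\<in>neighborhood G cell M w. L)"
    using neighborhood_level[OF assms] overlap by (intro sum_mono) blast
  also have "\<dots> \<le> L ^ Suc M" using Suc by simp
  finally show ?case .
qed

lemma neighborhood_add:
  assumes "w \<in> level G n" "v \<in> neighborhood G cell a w" "u \<in> neighborhood G cell b v"
  shows "u \<in> neighborhood G cell (a + b) w"
  using assms(3)
proof (induction b arbitrary: u)
  case 0
  then show ?case using assms neighborhood_level[OF assms(1,2)] by (simp add: neighborhood_0 level_verts)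
next
  case (Suc b)
  have "v \<in> level G n" using neighborhood_level[OF assms(1,2)] .
  from Suc.prems[unfolded neighborhood_Suc[OF this]] Suc.IH show ?case
    by (auto simp: neighborhood_Suc[OF assms(1)])
qed

lemma neighborhood_sym:
  assumes "w \<in> level G n" "v \<in> neighborhood G cell M w"
  shows "w \<in> neighborhood G cell M v"
  using assms(2)
proof (induction M arbitrary: v)
  case 0
  then show ?case using assms(1) by (simp add: neighborhood_0 level_verts)
next
  case (Suc M)
  then obtain u where v: "v \<in> level G n" and u: "u \<in> neighborhood G cell M w" "touching cell u v"
    by (auto simp: neighborhood_Suc[OF assms(1)])
  have "u \<in> level G n" using neighborhood_level[OF assms(1) u(1)] .
  then have "u \<in> neighborhood G cell (Suc 0) v"
    using v u by (simp add: neighborhood_Suc[OF v] neighborhood_0 level_verts touching_sym)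
  from neighborhood_add[OF v this Suc.IH[OF u(1)]] show ?case by simp
qed

text \<open>The hypothesis concerns radius \<open>M + 1\<close> only. Each further link of a chain
  survives under \<open>parent\<close>, because parents of touching vertices touch, so the gain of
  one unit persists for every larger radius.\<close>

lemma parent_neighborhood:
  assumes M: "\<And>w. w \<in> verts G \<Longrightarrow>
      parent G ` neighborhood G cell (M + 1) w \<subseteq> neighborhood G cell M (parent G w)"
    and w: "w \<in> level G (Suc n)" and v: "v \<in> neighborhood G cell (M + Suc j) w"
  shows "parent G v \<in> neighborhood G cell (M + j) (parent G w)"
  using v
proof (induction j arbitrary: v)
  case 0
  then show ?case using M[OF level_verts[OF w]] by auto
next
  case (Suc j)
  then obtain u where v: "v \<in> level G (Suc n)" and u: "u \<in> neighborhood G cell (M + Suc j) w"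
    "touching cell u v"
    using neighborhood_Suc[OF w, of "M + Suc j"] by auto
  have "parent G w \<in> level G n" "parent G v \<in> level G n" using w v by (auto simp: level_Suc_iff)
  moreover have "touching cell (parent G u) (parent G v)"
    using u v neighborhood_level[OF w u(1)] by (intro touching_parent level_verts)
  ultimately show ?case
    using Suc.IH[OF u(1)] neighborhood_Suc[of "parent G w" n "M + j"] by auto
qed

text \<open>Iterates the gain of one unit per generation until the radius has dropped to
  \<open>M\<close>, below which nothing more is gained.\<close>

lemma ancestor_neighborhood:
  assumes M: "\<And>w. w \<in> verts G \<Longrightarrow>
      parent G ` neighborhood G cell (M + 1) w \<subseteq> neighborhood G cell M (parent G w)"
    and w: "w \<in> level G (n + i)" and v: "v \<in> neighborhood G cell (M + i) w"
  shows "(parent G ^^ i) v \<in> neighborhood G cell M ((parent G ^^ i) w)"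
  using w v
proof (induction i arbitrary: v w)
  case (Suc i)
  have "parent G w \<in> level G (n + i)" using Suc.prems(1) by (simp add: level_Suc_iff)
  from Suc.IH[OF this parent_neighborhood[OF M _ Suc.prems(2)]] Suc.prems(1)
  show ?case by (simp add: funpow_swap1)
qed simp

end

section \<open>Martingales along the tree\<close>

text \<open>The boundary point 0 is included because Jensen's inequality is applied to absolute
  values that may vanish; at 0 convexity amounts to \<open>scale\<close>.\<close>

lemma convex_on_powr:
  fixes q :: real
  assumes "1 \<le> q"
  shows "convex_on {0..} (\<lambda>x. x powr q)"
proof -
  have scale: "(t * y) powr q \<le> t * y powr q" if "0 \<le> t" "t \<le> 1" "0 \<le> y" for t y :: real
  proof -
    have "t powr q \<le> t powr 1"
      using powr_mono'[of 1 q t] that assms by simp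
    then show ?thesis using that by (simp add: powr_mult mult_right_mono)
  qed
  show ?thesis
  proof (rule convex_on_linorderI)
    fix t x y :: real
    assume t: "0 < t" "t < 1" and xy: "x \<in> {0..}" "y \<in> {0..}" "x < y"
    show "((1 - t) *\<^sub>R x + t *\<^sub>R y) powr q \<le> (1 - t) * x powr q + t * y powr q"
    proof (cases "x = 0")
      case True
      then show ?thesis using scale[of t y] t xy by simp
    next
      case False
      then show ?thesis
        using convex_onD[OF powr_convex[OF assms], of t x y] t xy by simp
    qed
  qed simp
qed

text \<open>Summable L1 increments make the series of absolute increments integrable, hence finite
  almost everywhere. This yields pointwise convergence and also the majorant \<open>D\<close>, by
  which integrals over cells will pass to the limit.\<close>

lemma integrable_telescope_limit:
  fixes s :: "nat \<Rightarrow> 'a \<Rightarrow> real"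
  assumes int: "\<And>i. integrable M (s i)"
    and le: "\<And>i. (\<integral>x. \<bar>s (Suc i) x - s i x\<bar> \<partial>M) \<le> e i" and e: "summable e"
  obtains f D where "integrable M f" "integrable M D" "\<And>n. AE x in M. \<bar>s n x\<bar> \<le> D x"
    "AE x in M. (\<lambda>n. s n x) \<longlonglongrightarrow> f x"
proof -
  define d where "d = (\<lambda>i x. s (Suc i) x - s i x)"
  have d: "integrable M (d i)" for i using int by (simp add: d_def)
  have [measurable]: "s i \<in> borel_measurable M" "d i \<in> borel_measurable M" for i
    using int d by auto
  have sm: "summable (\<lambda>i. \<integral>x. \<bar>d i x\<bar> \<partial>M)"
    using le by (intro summable_comparison_test'[OF e, of 0]) (auto simp: d_def)
  have "(\<integral>\<^sup>+x. (\<Sum>i. ennreal \<bar>d i x\<bar>) \<partial>M) = (\<Sum>i. \<integral>\<^sup>+x. ennreal \<bar>d i x\<bar> \<partial>M)"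
    by (intro nn_integral_suminf) auto
  also have "\<dots> = (\<Sum>i. ennreal (\<integral>x. \<bar>d i x\<bar> \<partial>M))"
    using d by (simp add: nn_integral_eq_integral)
  also have "\<dots> = ennreal (\<Sum>i. \<integral>x. \<bar>d i x\<bar> \<partial>M)"
    using sm by (intro suminf_ennreal2) auto
  finally have "(\<integral>\<^sup>+x. (\<Sum>i. ennreal \<bar>d i x\<bar>) \<partial>M) \<noteq> \<infinity>" by simp
  then have "AE x in M. (\<Sum>i. ennreal \<bar>d i x\<bar>) \<noteq> \<infinity>"
    by (intro nn_integral_PInf_AE) auto
  then have AE: "AE x in M. summable (\<lambda>i. \<bar>d i x\<bar>)"
    by eventually_elim (auto intro: summable_suminf_not_top)
  define D where "D = (\<lambda>x. \<bar>s 0 x\<bar> + (\<Sum>i. \<bar>d i x\<bar>))"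
  have D: "integrable M D"
    unfolding D_def using AE sm int d
    by (intro Bochner_Integration.integrable_add integrable_suminf) auto
  have tel: "s n x = s 0 x + (\<Sum>i<n. d i x)" for n x
    using sum_lessThan_telescope[of "\<lambda>i. s i x" n] by (simp add: d_def)
  have sD: "AE x in M. \<bar>s n x\<bar> \<le> D x" for n
    using AE
  proof eventually_elim
    fix x assume "summable (\<lambda>i. \<bar>d i x\<bar>)"
    then have "(\<Sum>i<n. \<bar>d i x\<bar>) \<le> (\<Sum>i. \<bar>d i x\<bar>)" by (intro sum_le_suminf) auto
    moreover have "\<bar>\<Sum>i<n. d i x\<bar> \<le> (\<Sum>i<n. \<bar>d i x\<bar>)" by (rule sum_abs)
    ultimately show "\<bar>s n x\<bar> \<le> D x" unfolding tel[of n x] D_def by linarith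
  qed
  \<comment> \<open>Taking \<open>lim\<close> at every point, with an unspecified value where the
    sequence diverges, makes \<open>f\<close> measurable on the whole space.\<close>
  define f where "f = (\<lambda>x. lim (\<lambda>n. s n x))"
  have lim: "AE x in M. (\<lambda>n. s n x) \<longlonglongrightarrow> f x"
    using AE
  proof eventually_elim
    fix x assume "summable (\<lambda>i. \<bar>d i x\<bar>)"
    then have "summable (\<lambda>i. d i x)" by (rule summable_rabs_cancel)
    then have "(\<lambda>n. s 0 x + (\<Sum>i<n. d i x)) \<longlonglongrightarrow> s 0 x + (\<Sum>i. d i x)"
      by (intro tendsto_add summable_LIMSEQ tendsto_const)
    moreover have "(\<lambda>n. s 0 x + (\<Sum>i<n. d i x)) = (\<lambda>n. s n x)"
      by (rule ext, rule tel[symmetric])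
    ultimately have "(\<lambda>n. s n x) \<longlonglongrightarrow> s 0 x + (\<Sum>i. d i x)" by argo
    then have "convergent (\<lambda>n. s n x)" by (rule convergentI)
    then show "(\<lambda>n. s n x) \<longlonglongrightarrow> f x"
      unfolding f_def by (rule convergent_LIMSEQ_iff[THEN iffD1])
  qed
  have f: "f \<in> borel_measurable M" unfolding f_def by measurable
  have "AE x in M. norm (s n x) \<le> D x" for n
    unfolding real_norm_def by (rule sD)
  then have "integrable M f"
    using borel_measurable_integrable[OF int]
    by (rule integrable_dominated_convergence[OF f _ D lim, rotated])
  then show ?thesis using that D sD lim by blast
qed

context rooted_tree
begin

lemma sum_level_descendants:
  fixes g :: "'t \<Rightarrow> real"
  shows "(\<Sum>u\<in>level G (n + m). g u) = (\<Sum>w\<in>level G n. \<Sum>u\<in>descendants G m w. g u)"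
proof -
  have "(\<Sum>u\<in>level G (n + m). g u)
      = (\<Sum>w\<in>level G n. \<Sum>u | u \<in> level G (n + m) \<and> (parent G ^^ m) u = w. g u)"
    using ancestor_level by (intro sum.group[symmetric] finite_level) auto
  then show ?thesis by (simp add: descendants_eq cong: sum.cong)
qed

lemma sum_descendants_Suc:
  fixes g :: "'t \<Rightarrow> real"
  assumes w: "w \<in> level G n"
  shows "(\<Sum>u\<in>descendants G (Suc m) w. g u) = (\<Sum>v\<in>children G w. \<Sum>u\<in>descendants G m v. g u)"
  unfolding descendants.simps
proof (rule sum.UNION_disjoint)
  have ch: "v \<in> level G (Suc n)" if "v \<in> children G w" for v
    using that by (simp add: children_eq[OF w])
  show "finite (children G w)" using w finite_children level_verts by blast
  show "\<forall>v\<in>children G w. finite (descendants G m v)"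
    using ch finite_descendants level_verts by blast
  show "\<forall>i\<in>children G w. \<forall>j\<in>children G w. i \<noteq> j \<longrightarrow> descendants G m i \<inter> descendants G m j = {}"
    by (auto simp: descendants_eq[OF ch])
qed

end

section \<open>Step functions, averages and limits of martingales on the levels of the tree\<close>

locale measured_tree = tree_cells G K cell L + prob_space \<mu>
  for G :: "'t rooted_graph" and K :: "'a::metric_space set" and cell L and \<mu> :: "'a measure" +
  assumes regular: "borel_regular_on K \<mu>"
    and prob_cell_pos: "w \<in> verts G \<Longrightarrow> 0 < prob (cell w)"
    and prob_children: "w \<in> verts G \<Longrightarrow> prob (cell w) = (\<Sum>v\<in>children G w. prob (cell v))"
begin

lemma space_eq: "space \<mu> = K"
  using regular by (simp add: borel_regular_on_def)

lemma cell_sets [measurable]: "w \<in> verts G \<Longrightarrow> cell w \<in> sets \<mu>"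
proof -
  assume w: "w \<in> verts G"
  then have "cell w \<in> sets (restrict_space borel K)"
    using cell_subset[OF w] compact_imp_closed[OF compact_cell[OF w]]
    by (auto simp: sets_restrict_space image_iff intro!: bexI[of _ "cell w"])
  then show ?thesis using regular by (auto simp: borel_regular_on_def)
qed

lemma sum_children_descendants:
  fixes g :: "'t \<Rightarrow> real"
  assumes w: "w \<in> level G n"
    and g: "\<And>v. v \<in> verts G \<Longrightarrow> g v = (\<Sum>u\<in>children G v. g u)"
  shows "g w = (\<Sum>v\<in>descendants G m w. g v)"
  using w
proof (induction m arbitrary: w n)
  case (Suc m)
  have wv: "w \<in> verts G" using Suc.prems by (rule level_verts)
  have ch: "v \<in> level G (Suc n)" if "v \<in> children G w" for v
    using that by (simp add: children_eq[OF Suc.prems])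
  have "g w = (\<Sum>v\<in>children G w. g v)" using g[OF wv] .
  also have "\<dots> = (\<Sum>v\<in>children G w. \<Sum>u\<in>descendants G m v. g u)"
    using Suc.IH ch by (intro sum.cong) auto
  finally show ?case by (simp only: sum_descendants_Suc[OF Suc.prems])
qed simp

lemma prob_descendants:
  "w \<in> level G n \<Longrightarrow> prob (cell w) = (\<Sum>v\<in>descendants G m w. prob (cell v))"
  using sum_children_descendants[of w n "\<lambda>v. prob (cell v)"] prob_children by blast

text \<open>Where cells overlap the coefficients add up, so the expected value is taken only almost
  everywhere. In exchange, integrability and the integral follow from linearity.\<close>

definition step :: "nat \<Rightarrow> ('t \<Rightarrow> real) \<Rightarrow> 'a \<Rightarrow> real" where
  "step n c x = (\<Sum>v\<in>level G n. c v * indicator (cell v) x)"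

lemma integrable_indicator_cell: "w \<in> verts G \<Longrightarrow> integrable \<mu> (indicator (cell w) :: 'a \<Rightarrow> real)"
  by (simp add: less_top[symmetric])

lemma integrable_step: "integrable \<mu> (step n c)"
  unfolding step_def using integrable_indicator_cell level_verts
  by (intro Bochner_Integration.integrable_sum integrable_mult_right) blast

text \<open>The cells of one level overlap in null sets, because they cover \<open>K\<close> and their measures
  add up to one.\<close>

lemma AE_unique_cell: "AE x in \<mu>. \<exists>!v. v \<in> level G n \<and> x \<in> cell v"
proof -
  define h :: "'a \<Rightarrow> real" where "h x = (\<Sum>v\<in>level G n. indicator (cell v) x) - 1" for x
  have h_card: "h x = real (card {v \<in> level G n. x \<in> cell v}) - 1" for x
    by (simp add: h_def indicator_def finite_level sum.If_cases Int_def)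
  have cover: "{v \<in> level G n. x \<in> cell v} \<noteq> {}" if "x \<in> space \<mu>" for x
    using that cell_eq_descendants[of "base G" n] by (auto simp: space_eq level_eq_descendants)
  have "integrable \<mu> h"
    unfolding h_def using integrable_indicator_cell level_verts
    by (intro Bochner_Integration.integrable_diff Bochner_Integration.integrable_sum) auto
  moreover have "AE x in \<mu>. 0 \<le> h x"
  proof (rule AE_I2)
    fix x assume "x \<in> space \<mu>"
    then have "0 < card {v \<in> level G n. x \<in> cell v}"
      using cover finite_level by (simp add: card_gt_0_iff)
    then show "0 \<le> h x" by (simp add: h_card)
  qed
  moreover have "(\<integral>x. h x \<partial>\<mu>) = 0"
  proof -
    have "(\<integral>x. h x \<partial>\<mu>) = (\<Sum>v\<in>level G n. prob (cell v)) - 1"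
      unfolding h_def using integrable_indicator_cell level_verts
      by (subst Bochner_Integration.integral_diff)
        (auto simp: prob_space intro!: Bochner_Integration.integrable_sum sum.cong
          simp: integral_indicator cell_sets sets.Int_space_eq2)
    also have "\<dots> = 0"
      using prob_descendants[of "base G" 0 n] prob_space
      by (simp add: level_0 space_eq flip: level_eq_descendants)
    finally show ?thesis .
  qed
  ultimately have "AE x in \<mu>. h x = 0"
    by (simp add: integral_nonneg_eq_0_iff_AE)
  then show ?thesis
  proof eventually_elim
    fix x assume "h x = 0"
    then have "card {v \<in> level G n. x \<in> cell v} = 1" by (simp add: h_card)
    then obtain w where "{v \<in> level G n. x \<in> cell v} = {w}" by (rule card_1_singletonE)
    then have "v \<in> level G n \<and> x \<in> cell v \<longleftrightarrow> v = w" for v by blast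
    then show "\<exists>!v. v \<in> level G n \<and> x \<in> cell v" by simp
  qed
qed

lemma step_at:
  assumes "v \<in> level G n" "x \<in> cell v" "\<And>u. u \<in> level G n \<Longrightarrow> x \<in> cell u \<Longrightarrow> u = v"
  shows "step n c x = c v"
proof -
  have "c u * indicator (cell u) x = (if u = v then c v else 0)" if "u \<in> level G n" for u
    using assms(2) assms(3)[OF that] by (cases "u = v") (auto simp: indicator_def)
  then have "step n c x = (\<Sum>u\<in>level G n. if u = v then c v else 0)"
    unfolding step_def by (rule sum.cong[OF refl])
  then show ?thesis using assms(1) finite_level by simp
qed

text \<open>Almost every point lies in exactly one cell of the level, so a single term of the sum
  survives. This is why \<phi> may be arbitrary, even with \<phi> 0 different from 0.\<close>

lemma AE_step: "AE x in \<mu>. \<phi> (step n c x) = step n (\<lambda>v. \<phi> (c v)) x"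
  using AE_unique_cell[of n]
proof eventually_elim
  fix x assume "\<exists>!v. v \<in> level G n \<and> x \<in> cell v"
  then obtain v where v: "v \<in> level G n" "x \<in> cell v"
    "\<And>u. u \<in> level G n \<Longrightarrow> x \<in> cell u \<Longrightarrow> u = v" by blast
  show "\<phi> (step n c x) = step n (\<lambda>v. \<phi> (c v)) x"
    by (simp add: step_at[OF v])
qed

lemma integral_step: "(\<integral>x. step n c x \<partial>\<mu>) = (\<Sum>v\<in>level G n. c v * prob (cell v))"
  unfolding step_def using integrable_indicator_cell level_verts
  by (subst Bochner_Integration.integral_sum)
    (auto intro!: sum.cong integrable_mult_right simp: cell_sets sets.Int_space_eq2)

text \<open>A point of \<open>cell w\<close> might also lie in a small cell below another vertex,
  but only in a null set; elsewhere membership in \<open>cell w\<close> is decided by the ancestor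
  of the small cell.\<close>

lemma AE_step_cell:
  assumes w: "w \<in> level G n"
  shows "AE x in \<mu>. indicator (cell w) x * step (n + m) c x
    = step (n + m) (\<lambda>v. if v \<in> descendants G m w then c v else 0) x"
  using AE_unique_cell[of n] AE_unique_cell[of "n + m"]
proof eventually_elim
  fix x
  assume unique: "\<exists>!v. v \<in> level G n \<and> x \<in> cell v"
    and "\<exists>!v. v \<in> level G (n + m) \<and> x \<in> cell v"
  then obtain v where v: "v \<in> level G (n + m)" "x \<in> cell v"
    "\<And>u. u \<in> level G (n + m) \<Longrightarrow> x \<in> cell u \<Longrightarrow> u = v" by blast
  have "(parent G ^^ m) v \<in> level G n" "x \<in> cell ((parent G ^^ m) v)"
    using ancestor_level v cell_ancestor level_verts by blast+
  then have "x \<in> cell w \<longleftrightarrow> (parent G ^^ m) v = w" using unique w by blast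
  then show "indicator (cell w) x * step (n + m) c x
      = step (n + m) (\<lambda>v. if v \<in> descendants G m w then c v else 0) x"
    using v(1) by (simp add: step_at[OF v] descendants_eq[OF w] indicator_def)
qed

lemma integral_step_cell:
  assumes w: "w \<in> level G n"
  shows "(LINT x:cell w|\<mu>. step (n + m) c x) = (\<Sum>v\<in>descendants G m w. c v * prob (cell v))"
proof -
  have [measurable]: "step k c \<in> borel_measurable \<mu>" for k c using integrable_step by blast
  have [measurable]: "cell w \<in> sets \<mu>" using w cell_sets level_verts by blast
  have "(LINT x:cell w|\<mu>. step (n + m) c x)
      = (\<integral>x. step (n + m) (\<lambda>v. if v \<in> descendants G m w then c v else 0) x \<partial>\<mu>)"
    unfolding set_lebesgue_integral_def using AE_step_cell[OF w, of m c]
    by (intro integral_cong_AE) auto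
  also have "\<dots> = (\<Sum>v\<in>level G (n + m). if v \<in> descendants G m w then c v * prob (cell v) else 0)"
    unfolding integral_step by (intro sum.cong) auto
  also have "\<dots> = (\<Sum>v\<in>descendants G m w. c v * prob (cell v))"
    using descendants_subset_level[OF w, of m] finite_level
    by (simp add: sum.If_cases Int_absorb1 flip: Collect_mem_eq)
  finally show ?thesis .
qed

text \<open>The conditional expectation of a function on a level, taken \<open>m\<close> levels
  above it.\<close>

definition average :: "nat \<Rightarrow> ('t \<Rightarrow> real) \<Rightarrow> 't \<Rightarrow> real" where
  "average m c w = (\<Sum>v\<in>descendants G m w. c v * prob (cell v)) / prob (cell w)"

lemma cell_average_step: "w \<in> level G n \<Longrightarrow> cell_average \<mu> cell (step (n + m) c) w = average m c w"
  by (simp add: cell_average_def average_def integral_step_cell)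

lemma average_0: "w \<in> verts G \<Longrightarrow> average 0 c w = c w"
  using prob_cell_pos[of w] by (simp add: average_def)

lemma average_children:
  assumes w: "w \<in> level G n"
  shows "average (Suc m) c w * prob (cell w) = (\<Sum>v\<in>children G w. average m c v * prob (cell v))"
proof -
  have ch: "v \<in> level G (Suc n)" if "v \<in> children G w" for v
    using that by (simp add: children_eq[OF w])
  have "average (Suc m) c w * prob (cell w) = (\<Sum>v\<in>descendants G (Suc m) w. c v * prob (cell v))"
    using prob_cell_pos[OF level_verts[OF w]] by (simp add: average_def)
  also have "\<dots> = (\<Sum>v\<in>children G w. \<Sum>u\<in>descendants G m v. c u * prob (cell u))"
    by (rule sum_descendants_Suc[OF w])
  also have "\<dots> = (\<Sum>v\<in>children G w. average m c v * prob (cell v))"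
    using prob_cell_pos level_verts ch by (intro sum.cong) (force simp: average_def)+
  finally show ?thesis .
qed

text \<open>Jensen's inequality; the relative masses of the descendants are probability weights
  because masses are additive along the tree.\<close>

lemma average_powr_le:
  assumes w: "w \<in> level G n" and q: "1 \<le> q"
  shows "\<bar>average m c w\<bar> powr q * prob (cell w)
    \<le> (\<Sum>v\<in>descendants G m w. \<bar>c v\<bar> powr q * prob (cell v))"
proof -
  let ?D = "descendants G m w" and ?P = "prob (cell w)"
  have P: "0 < ?P" using prob_cell_pos[OF level_verts[OF w]] .
  have fin: "finite ?D" using finite_descendants[OF level_verts[OF w]] .
  have sum1: "(\<Sum>v\<in>?D. prob (cell v) / ?P) = 1"
    using prob_descendants[OF w, of m] P by (simp flip: sum_divide_distrib)
  then have ne: "?D \<noteq> {}" by force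
  have "\<bar>average m c w\<bar> \<le> (\<Sum>v\<in>?D. (prob (cell v) / ?P) *\<^sub>R \<bar>c v\<bar>)"
    unfolding average_def sum_divide_distrib
    using P by (intro order.trans[OF sum_abs] sum_mono) (auto simp: abs_mult field_simps)
  then have "\<bar>average m c w\<bar> powr q \<le> (\<Sum>v\<in>?D. (prob (cell v) / ?P) *\<^sub>R \<bar>c v\<bar>) powr q"
    using q by (intro powr_mono2) auto
  also have "\<dots> \<le> (\<Sum>v\<in>?D. prob (cell v) / ?P * \<bar>c v\<bar> powr q)"
    using fin ne sum1 by (intro convex_on_sum[OF _ _ convex_on_powr[OF q]]) auto
  finally have "\<bar>average m c w\<bar> powr q * ?P \<le> (\<Sum>v\<in>?D. prob (cell v) / ?P * \<bar>c v\<bar> powr q) * ?P"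
    using P by (intro mult_right_mono) auto
  also have "\<dots> = (\<Sum>v\<in>?D. \<bar>c v\<bar> powr q * prob (cell v))"
    using P by (simp add: sum_distrib_right) (simp add: mult.commute)
  finally show ?thesis .
qed

lemma sum_average_powr_le:
  assumes q: "1 \<le> q"
  shows "(\<Sum>w\<in>level G n. \<bar>average m c w\<bar> powr q * prob (cell w))
    \<le> (\<Sum>v\<in>level G (n + m). \<bar>c v\<bar> powr q * prob (cell v))"
proof -
  have "(\<Sum>w\<in>level G n. \<bar>average m c w\<bar> powr q * prob (cell w))
      \<le> (\<Sum>w\<in>level G n. \<Sum>v\<in>descendants G m w. \<bar>c v\<bar> powr q * prob (cell v))"
    by (intro sum_mono average_powr_le[OF _ q])
  also have "\<dots> = (\<Sum>v\<in>level G (n + m). \<bar>c v\<bar> powr q * prob (cell v))"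
    by (rule sum_level_descendants[symmetric])
  finally show ?thesis .
qed

text \<open>Orthogonality of martingale increments: over a cell of level \<open>n\<close> the finer
  factor integrates to \<open>a w\<close> times the mass, so the mixed product reduces to the second
  moment of the coarser one.\<close>

lemma integral_step_product:
  assumes "\<And>w. w \<in> verts G \<Longrightarrow> a w * prob (cell w) = (\<Sum>v\<in>children G w. a v * prob (cell v))"
  shows "(\<integral>x. step n a x * step (n + m) a x \<partial>\<mu>) = (\<Sum>w\<in>level G n. (a w)\<^sup>2 * prob (cell w))"
proof -
  have int: "integrable \<mu> (\<lambda>x. indicator (cell w) x * step (n + m) a x)" if "w \<in> level G n" for w
    using integrable_real_mult_indicator[OF cell_sets integrable_step] level_verts[OF that]
    by (simp add: mult.commute)
  have "(\<integral>x. step n a x * step (n + m) a x \<partial>\<mu>)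
      = (\<integral>x. (\<Sum>w\<in>level G n. a w * (indicator (cell w) x * step (n + m) a x)) \<partial>\<mu>)"
    by (simp add: step_def[of n] sum_distrib_right mult.assoc)
  also have "\<dots> = (\<Sum>w\<in>level G n. a w * (LINT x:cell w|\<mu>. step (n + m) a x))"
    using int by (subst Bochner_Integration.integral_sum) (auto simp: set_lebesgue_integral_def)
  also have "\<dots> = (\<Sum>w\<in>level G n. (a w)\<^sup>2 * prob (cell w))"
  proof (intro sum.cong refl)
    fix w assume w: "w \<in> level G n"
    show "a w * (LINT x:cell w|\<mu>. step (n + m) a x) = (a w)\<^sup>2 * prob (cell w)"
      using sum_children_descendants[OF w, of "\<lambda>v. a v * prob (cell v)"] assms
      by (simp add: integral_step_cell[OF w] power2_eq_square)
  qed
  finally show ?thesis .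
qed

lemma integrable_step_product: "integrable \<mu> (\<lambda>x. step n a x * step m b x)"
proof (rule Bochner_Integration.integrable_bound[where f = "\<lambda>x. (\<Sum>v\<in>level G n. \<bar>a v\<bar>) * step m (\<lambda>v. \<bar>b v\<bar>) x"])
  show "AE x in \<mu>. norm (step n a x * step m b x) \<le> norm ((\<Sum>v\<in>level G n. \<bar>a v\<bar>) * step m (\<lambda>v. \<bar>b v\<bar>) x)"
    using AE_step[of abs m b]
  proof eventually_elim
    fix x assume b: "\<bar>step m b x\<bar> = step m (\<lambda>v. \<bar>b v\<bar>) x"
    have "\<bar>step n a x\<bar> \<le> (\<Sum>v\<in>level G n. \<bar>a v\<bar>)"
      unfolding step_def by (intro order.trans[OF sum_abs] sum_mono) (auto simp: indicator_def)
    then show "norm (step n a x * step m b x) \<le> norm ((\<Sum>v\<in>level G n. \<bar>a v\<bar>) * step m (\<lambda>v. \<bar>b v\<bar>) x)"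
      unfolding b[symmetric] by (auto simp: abs_mult mult_right_mono sum_nonneg)
  qed
qed (use integrable_step in \<open>auto intro!: borel_measurable_times\<close>)

text \<open>By orthogonality the second moments increase and their differences are squared L2
  distances, so the bound gives a Cauchy property. A fast subsequence converges almost everywhere
  under an integrable majorant, and dominated convergence keeps the cell integrals, which are
  constant along the subsequence from the level of the cell on.\<close>

lemma martingale_limit:
  assumes mart: "\<And>w. w \<in> verts G \<Longrightarrow> a w * prob (cell w) = (\<Sum>v\<in>children G w. a v * prob (cell v))"
    and bound: "\<And>n. (\<Sum>v\<in>level G n. (a v)\<^sup>2 * prob (cell v)) \<le> C"
  shows "\<exists>f r. integrable \<mu> f \<and> (AE x in \<mu>. (\<lambda>i. step (r i) a x) \<longlonglongrightarrow> f x) \<and>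
    (\<forall>w\<in>verts G. cell_average \<mu> cell f w = a w)"
proof -
  define E where "E n = (\<Sum>v\<in>level G n. (a v)\<^sup>2 * prob (cell v))" for n
  have dist2: "(\<integral>x. (step (n + m) a x - step n a x)\<^sup>2 \<partial>\<mu>) = E (n + m) - E n" for n m
  proof -
    have "(\<integral>x. (step (n + m) a x - step n a x)\<^sup>2 \<partial>\<mu>)
      = (\<integral>x. step (n + m) a x * step (n + m) a x + step n a x * step n a x
          - 2 * (step n a x * step (n + m) a x) \<partial>\<mu>)"
      by (simp add: power2_eq_square algebra_simps)
    also have "\<dots> = E (n + m) + E n - 2 * E n"
      using integral_step_product[of a "n + m" 0, OF mart] integral_step_product[of a n 0, OF mart]
        integral_step_product[of a n m, OF mart]
      by (simp add: integrable_step_product E_def)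
    finally show ?thesis by simp
  qed
  have "0 \<le> E (n + 1) - E n" for n
    unfolding dist2[symmetric] by (intro integral_nonneg_AE) auto
  then have mono: "incseq E" by (intro incseq_SucI) simp
  then obtain l where l: "E \<longlonglongrightarrow> l" "\<And>n. E n \<le> l"
    using incseq_convergent[of E C] bound unfolding E_def by blast
  \<comment> \<open>Squared distances of size (1/4)^i correspond to L1 distances of size (1/2)^i,
    which are summable.\<close>
  have ev: "\<exists>N. \<forall>n\<ge>N. l - E n < (1/4) ^ i" for i :: nat
  proof -
    have "eventually (\<lambda>n. l - (1/4) ^ i < E n) sequentially"
      by (rule order_tendstoD(1)[OF l(1)]) simp
    then show ?thesis by (force simp: eventually_sequentially)
  qed
  have "\<exists>r. strict_mono r \<and> (\<forall>i. l - E (r i) < (1/4) ^ i)"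
  proof -
    obtain N where N: "\<And>i n. N i \<le> n \<Longrightarrow> l - E n < (1/4) ^ i" using ev by metis
    \<comment> \<open>The partial sums ensure \<open>N i \<le> r i\<close>, and the extra summand
      \<open>i\<close> makes the sequence strictly increasing.\<close>
    define r where "r i = i + (\<Sum>j\<le>i. N j)" for i
    have "N i \<le> r i" for i
      unfolding r_def by (rule trans_le_add2, rule member_le_sum) auto
    moreover have "strict_mono r" by (simp add: strict_mono_Suc_iff r_def)
    ultimately show ?thesis using N by blast
  qed
  then obtain r where r: "strict_mono r" and rE: "\<And>i. l - E (r i) < (1/4) ^ i" by blast
  define s where "s i = step (r i) a" for i
  have int: "integrable \<mu> (s i)" for i by (simp add: s_def integrable_step)
  have step_le: "(\<integral>x. \<bar>s (Suc i) x - s i x\<bar> \<partial>\<mu>) \<le> (1/2) ^ i" for i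
  proof -
    have "r i \<le> r (Suc i)" using r by (simp add: strict_mono_less_eq)
    then obtain m where m: "r (Suc i) = r i + m" using le_Suc_ex by blast
    have sq: "integrable \<mu> (\<lambda>x. (s (Suc i) x - s i x)\<^sup>2)"
      unfolding s_def power2_eq_square left_diff_distrib right_diff_distrib
      by (intro Bochner_Integration.integrable_diff integrable_step_product)
    \<comment> \<open>Cauchy--Schwarz, by AM-GM with the weight \<open>2 ^ i\<close>\<close>
    have "\<bar>t\<bar> \<le> (2 ^ i * t\<^sup>2 + (1/2) ^ i) / 2" for t :: real
    proof -
      have "0 \<le> (2 ^ i * \<bar>t\<bar> - 1)\<^sup>2 * (1/2) ^ i" by simp
      also have "\<dots> = 2 ^ i * t\<^sup>2 + (1/2) ^ i - 2 * \<bar>t\<bar>"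
        by (simp add: power2_eq_square algebra_simps power_divide)
      finally show ?thesis by simp
    qed
    then have "(\<integral>x. \<bar>s (Suc i) x - s i x\<bar> \<partial>\<mu>)
        \<le> (\<integral>x. (2 ^ i * (s (Suc i) x - s i x)\<^sup>2 + (1/2) ^ i) / 2 \<partial>\<mu>)"
      using int sq by (intro integral_mono) auto
    also have "\<dots> = (2 ^ i * (E (r (Suc i)) - E (r i)) + (1/2) ^ i) / 2"
      using dist2[of "r i" m] sq by (simp add: prob_space m s_def)
    also have "\<dots> \<le> (2 ^ i * (1/4) ^ i + (1/2) ^ i) / 2"
      using l(2)[of "r (Suc i)"] rE[of i] by (intro divide_right_mono add_right_mono mult_left_mono) auto
    also have "(2::real) ^ i * (1/4) ^ i = (1/2) ^ i"
      by (simp flip: power_mult_distrib)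
    finally show ?thesis by simp
  qed
  have geometric: "summable (\<lambda>i. (1/2::real) ^ i)" by simp
  obtain f D where f: "integrable \<mu> f" and D: "integrable \<mu> D"
    "\<And>n. AE x in \<mu>. \<bar>s n x\<bar> \<le> D x" and lim: "AE x in \<mu>. (\<lambda>n. s n x) \<longlonglongrightarrow> f x"
    by (rule integrable_telescope_limit[OF int step_le geometric]) blast
  have "cell_average \<mu> cell f w = a w" if w: "w \<in> verts G" for w
  proof -
    define k where "k = depth G w"
    have wk: "w \<in> level G k" using w by (simp add: k_def level_def)
    have [measurable]: "cell w \<in> sets \<mu>" using w by simp
    have [measurable]: "s i \<in> borel_measurable \<mu>" "f \<in> borel_measurable \<mu>" for i
      using int f by auto
    have "(\<lambda>i. LINT x:cell w|\<mu>. s i x) \<longlonglongrightarrow> (LINT x:cell w|\<mu>. f x)"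
      unfolding set_lebesgue_integral_def
    proof (rule integral_dominated_convergence[where w = D])
      show "AE x in \<mu>. (\<lambda>i. indicator (cell w) x *\<^sub>R s i x) \<longlonglongrightarrow> indicator (cell w) x *\<^sub>R f x"
        using lim by eventually_elim (auto intro!: tendsto_intros)
      show "AE x in \<mu>. norm (indicator (cell w) x *\<^sub>R s i x) \<le> D x" for i
        using D(2)[of i] by eventually_elim (auto simp: indicator_def)
    qed (use D in auto)
    moreover have "eventually (\<lambda>i. (LINT x:cell w|\<mu>. s i x) = a w * prob (cell w)) sequentially"
      using eventually_ge_at_top[of k]
    proof eventually_elim
      fix i assume "k \<le> i"
      also have "i \<le> r i" using r by (rule seq_suble)
      finally obtain m where m: "r i = k + m" using le_Suc_ex by blast
      show "(LINT x:cell w|\<mu>. s i x) = a w * prob (cell w)"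
        unfolding s_def m integral_step_cell[OF wk]
        using sum_children_descendants[OF wk, of "\<lambda>v. a v * prob (cell v)" m] mart by simp
    qed
    ultimately have "(LINT x:cell w|\<mu>. f x) = a w * prob (cell w)"
      by (metis LIMSEQ_unique tendsto_eventually)
    then show ?thesis using prob_cell_pos[OF w] by (simp add: cell_average_def)
  qed
  then show ?thesis using f lim unfolding s_def by blast
qed

text \<open>Fatou's lemma along the almost everywhere convergent subsequence; no convergence in the
  norm with exponent \<open>q\<close> is used, so exponents above 2 are covered too.\<close>

lemma in_Lp_step_limit:
  assumes q: "1 \<le> q" and f: "f \<in> borel_measurable \<mu>"
    and lim: "AE x in \<mu>. (\<lambda>i. step (r i) a x) \<longlonglongrightarrow> f x"
    and bound: "\<And>n. (\<Sum>v\<in>level G n. \<bar>a v\<bar> powr q * prob (cell v)) \<le> C"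
  shows "in_Lp q \<mu> f"
proof -
  have [measurable]: "step n a \<in> borel_measurable \<mu>" for n using integrable_step by blast
  have step_int: "(\<integral>\<^sup>+x. ennreal (\<bar>step n a x\<bar> powr q) \<partial>\<mu>) \<le> ennreal C" for n
  proof -
    have "(\<integral>\<^sup>+x. ennreal (\<bar>step n a x\<bar> powr q) \<partial>\<mu>)
        = (\<integral>\<^sup>+x. ennreal (step n (\<lambda>v. \<bar>a v\<bar> powr q) x) \<partial>\<mu>)"
      using AE_step[of "\<lambda>t. \<bar>t\<bar> powr q" n a] by (intro nn_integral_cong_AE) auto
    also have "\<dots> = ennreal (\<integral>x. step n (\<lambda>v. \<bar>a v\<bar> powr q) x \<partial>\<mu>)"
      by (intro nn_integral_eq_integral integrable_step AE_I2) (auto simp: step_def intro!: sum_nonneg)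
    also have "\<dots> \<le> ennreal C" using bound by (simp add: integral_step ennreal_leI)
    finally show ?thesis .
  qed
  have "(\<integral>\<^sup>+x. ennreal (\<bar>f x\<bar> powr q) \<partial>\<mu>)
      = (\<integral>\<^sup>+x. liminf (\<lambda>i. ennreal (\<bar>step (r i) a x\<bar> powr q)) \<partial>\<mu>)"
  proof (rule nn_integral_cong_AE)
    show "AE x in \<mu>. ennreal (\<bar>f x\<bar> powr q) = liminf (\<lambda>i. ennreal (\<bar>step (r i) a x\<bar> powr q))"
      using lim
    proof eventually_elim
      fix x assume "(\<lambda>i. step (r i) a x) \<longlonglongrightarrow> f x"
      then have "(\<lambda>i. ennreal (\<bar>step (r i) a x\<bar> powr q)) \<longlonglongrightarrow> ennreal (\<bar>f x\<bar> powr q)"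
        using q by (intro tendsto_ennrealI tendsto_powr' tendsto_rabs tendsto_const) auto
      then show "ennreal (\<bar>f x\<bar> powr q) = liminf (\<lambda>i. ennreal (\<bar>step (r i) a x\<bar> powr q))"
        by (intro lim_imp_Liminf[symmetric]) auto
    qed
  qed
  also have "\<dots> \<le> liminf (\<lambda>i. \<integral>\<^sup>+x. ennreal (\<bar>step (r i) a x\<bar> powr q) \<partial>\<mu>)"
    by (intro nn_integral_liminf) auto
  also have "\<dots> \<le> ennreal C"
    using step_int by (intro Liminf_le) auto
  finally have "(\<integral>\<^sup>+x. ennreal (\<bar>f x\<bar> powr q) \<partial>\<mu>) < \<infinity>"
    by (auto simp: le_less_trans)
  then have "integrable \<mu> (\<lambda>x. \<bar>f x\<bar> powr q)"
    using f by (intro integrableI_bounded) auto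
  then show ?thesis using f by (simp add: in_Lp_def)
qed

end

section \<open>Comparison of energies\<close>

text \<open>The sum is at most its number of terms times the largest one, whose power occurs on the
  right. No convexity enters, so any nonnegative exponent is allowed.\<close>

lemma abs_sum_powr_le:
  fixes x :: "'i \<Rightarrow> real"
  assumes fin: "finite I" and p: "0 \<le> p"
  shows "\<bar>\<Sum>i\<in>I. x i\<bar> powr p \<le> real (card I) powr p * (\<Sum>i\<in>I. \<bar>x i\<bar> powr p)"
proof (cases "I = {}")
  case False
  define m where "m = Max ((\<lambda>i. \<bar>x i\<bar>) ` I)"
  have le: "\<bar>x i\<bar> \<le> m" if "i \<in> I" for i
    unfolding m_def using fin that by (intro Max_ge) auto
  have "m \<in> (\<lambda>i. \<bar>x i\<bar>) ` I"
    unfolding m_def using fin False by (intro Max_in) auto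
  then obtain j where j: "j \<in> I" "m = \<bar>x j\<bar>" by blast
  have "\<bar>\<Sum>i\<in>I. x i\<bar> \<le> (\<Sum>i\<in>I. \<bar>x i\<bar>)" by (rule sum_abs)
  also have "\<dots> \<le> real (card I) * m" using le by (intro sum_bounded_above) auto
  finally have "\<bar>\<Sum>i\<in>I. x i\<bar> powr p \<le> (real (card I) * m) powr p"
    using p by (intro powr_mono2) auto
  also have "\<dots> = real (card I) powr p * \<bar>x j\<bar> powr p"
    using j by (simp add: powr_mult)
  also have "\<dots> \<le> real (card I) powr p * (\<Sum>i\<in>I. \<bar>x i\<bar> powr p)"
    using fin j by (intro mult_left_mono member_le_sum) auto
  finally show ?thesis .
qed simp

text \<open>Ordered pairs: an edge occurs twice, which the factor 1/2 in the energy offsets, and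
  diagonal pairs contribute 0.\<close>

definition touching_pairs :: "('t \<Rightarrow> 'a set) \<Rightarrow> 't set \<Rightarrow> ('t \<times> 't) set" where
  "touching_pairs cell A = {(w, v). w \<in> A \<and> v \<in> A \<and> touching cell w v}"

lemma energy_eq: "energy cell p A f = 1 / 2 * (\<Sum>(w, v)\<in>touching_pairs cell A. \<bar>f w - f v\<bar> powr p)"
  by (simp add: energy_def touching_pairs_def)

lemma finite_touching_pairs: "finite A \<Longrightarrow> finite (touching_pairs cell A)"
  by (rule finite_subset[of _ "A \<times> A"]) (auto simp: touching_pairs_def)

lemma touching_pairs_mono: "A \<subseteq> B \<Longrightarrow> touching_pairs cell A \<subseteq> touching_pairs cell B"
  by (auto simp: touching_pairs_def)

lemma energy_nonneg: "0 \<le> energy cell p A f"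
  by (auto simp: energy_eq intro!: sum_nonneg)

lemma energy_cong: "(\<And>v. v \<in> A \<Longrightarrow> f v = g v) \<Longrightarrow> energy cell p A f = energy cell p A g"
  by (auto simp: energy_eq touching_pairs_def intro!: sum.cong)

lemma energy_le_sum:
  assumes "\<And>u v. u \<in> A \<Longrightarrow> v \<in> A \<Longrightarrow> touching cell u v \<Longrightarrow>
    \<bar>f u - f v\<bar> powr p \<le> (\<Sum>i\<in>I. c i * \<bar>g i u - g i v\<bar> powr p)"
  shows "energy cell p A f \<le> (\<Sum>i\<in>I. c i * energy cell p A (g i))"
proof -
  have "energy cell p A f
      \<le> 1 / 2 * (\<Sum>(u, v)\<in>touching_pairs cell A. \<Sum>i\<in>I. c i * \<bar>g i u - g i v\<bar> powr p)"
    unfolding energy_eq using assms by (intro mult_left_mono sum_mono) (auto simp: touching_pairs_def)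
  also have "\<dots> = 1 / 2 * (\<Sum>i\<in>I. \<Sum>(u, v)\<in>touching_pairs cell A. c i * \<bar>g i u - g i v\<bar> powr p)"
    by (simp add: case_prod_beta sum.swap[of _ I])
  also have "\<dots> = (\<Sum>i\<in>I. c i * energy cell p A (g i))"
    by (simp add: energy_eq sum_distrib_left case_prod_beta algebra_simps)
  finally show ?thesis .
qed

lemma energy_mono:
  assumes "\<And>u v. u \<in> A \<Longrightarrow> v \<in> A \<Longrightarrow> \<bar>f u - f v\<bar> \<le> \<bar>g u - g v\<bar>" "0 \<le> p"
  shows "energy cell p A f \<le> energy cell p A g"
proof -
  have "\<bar>f u - f v\<bar> powr p \<le> \<bar>g u - g v\<bar> powr p" if "u \<in> A" "v \<in> A" for u v
    using assms that by (intro powr_mono2) auto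
  then show ?thesis
    using energy_le_sum[where I = "{()}" and c = "\<lambda>_. 1" and g = "\<lambda>_. g" and f = f and A = A and
        cell = cell and p = p] by simp
qed

lemma tendsto_energy:
  assumes "\<And>v. v \<in> A \<Longrightarrow> (\<lambda>i. f i v) \<longlonglongrightarrow> g v" "0 < p"
  shows "(\<lambda>i. energy cell p A (f i)) \<longlonglongrightarrow> energy cell p A g"
  unfolding energy_eq using assms
  by (auto simp: touching_pairs_def intro!: tendsto_intros tendsto_powr')

section \<open>Energies under coverings, and cutoff functions obtained from conductances\<close>

context tree_cells
begin

lemma covering_members:
  assumes "is_covering G cell N\<^sub>T N A \<G> (\<lambda>X. X)"
  shows "finite \<G>" "X \<in> \<G> \<Longrightarrow> X \<subseteq> A" "w \<in> A \<Longrightarrow> card {X \<in> \<G>. w \<in> X} \<le> N\<^sub>T"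
proof -
  show "finite \<G>" using assms unfolding is_covering_def by (elim conjE)
  have "A = (\<Union>X\<in>\<G>. X)" using assms unfolding is_covering_def by (elim conjE)
  then show "X \<in> \<G> \<Longrightarrow> X \<subseteq> A" by blast
  have "\<forall>w\<in>A. card {X \<in> \<G>. w \<in> X} \<le> N\<^sub>T" using assms unfolding is_covering_def by (elim conjE)
  then show "w \<in> A \<Longrightarrow> card {X \<in> \<G>. w \<in> X} \<le> N\<^sub>T" by blast
qed

text \<open>Each edge of a chain of length at most \<open>N\<close> starting at \<open>u\<close> begins in the \<open>N\<close>-neighborhood
  of \<open>u\<close>, so that it is used by boundedly many pairs.\<close>

lemma energy_le_covering:
  assumes cov: "is_covering G cell N\<^sub>T N (level G n) \<G> (\<lambda>X. X)" and p: "0 \<le> p"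
  shows "energy cell p (level G n) f
    \<le> real N powr p * real N * real L ^ (N + 1) * (\<Sum>X\<in>\<G>. energy cell p X f)"
proof -
  define d where "d = (\<lambda>(a, b). \<bar>f a - f b\<bar> powr p)"
  have d0: "0 \<le> d e" for e by (simp add: d_def split: prod.split)
  \<comment> \<open>\<open>T u\<close> is the energy of all members of the cover near
    \<open>u\<close>. It dominates each link of each chain of length at most \<open>N\<close> from
    \<open>u\<close>, whichever member contains the link.\<close>
  define T where "T u = (\<Sum>X\<in>\<G>. \<Sum>e\<in>touching_pairs cell X.
    if fst e \<in> neighborhood G cell N u then d e else 0)" for u
  have fin: "finite \<G>" and sub: "\<And>X. X \<in> \<G> \<Longrightarrow> X \<subseteq> level G n"
    using covering_members[OF cov] by blast+
  have finp: "finite (touching_pairs cell X)" if "X \<in> \<G>" for X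
    using sub[OF that] finite_level by (meson finite_touching_pairs finite_subset)
  have T0: "0 \<le> T u" for u unfolding T_def using d0 by (auto intro!: sum_nonneg)
  have edge: "d (u, v) \<le> real N powr p * real N * T u"
    if uv: "u \<in> level G n" "v \<in> level G n" "touching cell u v" for u v
  proof -
    have "\<forall>u\<in>level G n. \<forall>v\<in>level G n. touching cell u v \<longrightarrow>
        (\<exists>l\<le>N. \<exists>ws :: nat \<Rightarrow> 't.
           (\<forall>j\<in>{1..l + 1}. ws j \<in> level G n) \<and> ws 1 = u \<and> ws (l + 1) = v \<and>
           (\<forall>j\<in>{1..l}. touching cell (ws j) (ws (j + 1)) \<and>
              (\<exists>i\<in>\<G>. {ws j, ws (j + 1)} \<subseteq> i)))"
      using cov unfolding is_covering_def by (elim conjE)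
    from mp[OF bspec[OF bspec[OF this uv(1)] uv(2)] uv(3)]
    obtain l ws where l: "l \<le> N" and ws: "\<forall>j\<in>{1..l + 1}. ws j \<in> level G n" "ws 1 = u"
        "ws (l + 1) = v" "\<forall>j\<in>{1..l}. touching cell (ws j) (ws (j + 1)) \<and>
              (\<exists>i\<in>\<G>. {ws j, ws (j + 1)} \<subseteq> i)"
      by (elim exE conjE)
    have nb: "ws (Suc j) \<in> neighborhood G cell j u" if "j \<le> l" for j
      using that
    proof (induction j)
      case 0
      then show ?case using ws(2) neighborhood_self[OF level_verts[OF uv(1)]] by simp
    next
      case (Suc j)
      then have "touching cell (ws (Suc j)) (ws (Suc (Suc j)))" "ws (Suc (Suc j)) \<in> level G n"
        using bspec[OF ws(4), of "Suc j"] bspec[OF ws(1), of "Suc (Suc j)"] by simp_all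
      then show ?case using Suc unfolding neighborhood_Suc[OF uv(1)] by fastforce
    qed
    have step: "d (ws j, ws (j + 1)) \<le> T u" if j: "j \<in> {1..l}" for j
    proof -
      obtain X where X: "X \<in> \<G>" "(ws j, ws (j + 1)) \<in> touching_pairs cell X"
        using bspec[OF ws(4) j] by (auto simp: touching_pairs_def)
      have "ws j \<in> neighborhood G cell (j - 1) u" using nb[of "j - 1"] j by auto
      then have "ws j \<in> neighborhood G cell N u"
        using subsetD[OF neighborhood_mono[OF level_verts[OF uv(1)], of "j - 1" N]] j l by auto
      then have "d (ws j, ws (j + 1)) = (if fst (ws j, ws (j + 1)) \<in> neighborhood G cell N u
          then d (ws j, ws (j + 1)) else 0)" by simp
      also have "\<dots> \<le> (\<Sum>e\<in>touching_pairs cell X. if fst e \<in> neighborhood G cell N u then d e else 0)"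
        using d0 finp[OF X(1)] X(2) by (intro member_le_sum) auto
      also have "\<dots> \<le> T u"
        unfolding T_def
      proof (rule member_le_sum[OF X(1) _ fin])
        show "0 \<le> (\<Sum>e\<in>touching_pairs cell Y. if fst e \<in> neighborhood G cell N u then d e else 0)"
          for Y using d0 by (intro sum_nonneg) simp
      qed
      finally show ?thesis .
    qed
    \<comment> \<open>Telescoping along the chain: the power of a sum of at most \<open>N\<close>
      terms costs \<open>real N powr p\<close>, and bounding each term by \<open>T u\<close> costs a
      further \<open>real N\<close>.\<close>
    have "f v - f u = (\<Sum>j\<in>{1..l}. f (ws (j + 1)) - f (ws j))"
      using sum_Suc_diff[of 1 l "\<lambda>j. f (ws j)"] ws(2,3) by simp
    then have "\<bar>f v - f u\<bar> powr p \<le> real l powr p * (\<Sum>j\<in>{1..l}. \<bar>f (ws (j + 1)) - f (ws j)\<bar> powr p)"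
      using abs_sum_powr_le[of "{1..l}" p "\<lambda>j. f (ws (j + 1)) - f (ws j)"] p by simp
    also have "\<dots> = real l powr p * (\<Sum>j\<in>{1..l}. d (ws j, ws (j + 1)))"
      by (simp add: d_def abs_minus_commute)
    also have "\<dots> \<le> real N powr p * (real N * T u)"
    proof (intro mult_mono powr_mono2)
      have "(\<Sum>j\<in>{1..l}. d (ws j, ws (j + 1))) \<le> real l * T u"
        using sum_bounded_above[of "{1..l}" _ "T u"] step by force
      also have "\<dots> \<le> real N * T u" using l T0 by (intro mult_right_mono) auto
      finally show "(\<Sum>j\<in>{1..l}. d (ws j, ws (j + 1))) \<le> real N * T u" .
    qed (use p l d0 in \<open>auto intro!: sum_nonneg\<close>)
    finally show ?thesis by (simp add: d_def abs_minus_commute mult.assoc)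
  qed
  have card_nb: "real (card {u \<in> level G n. a \<in> neighborhood G cell N u}) \<le> real L ^ N"
    if a: "a \<in> level G n" for a
  proof -
    have "{u \<in> level G n. a \<in> neighborhood G cell N u} \<subseteq> neighborhood G cell N a"
      using neighborhood_sym by blast
    then have "card {u \<in> level G n. a \<in> neighborhood G cell N u} \<le> L ^ N"
      using card_mono[OF finite_neighborhood] card_neighborhood[OF a] le_trans by blast
    then show ?thesis by (metis of_nat_le_iff of_nat_power)
  qed
  let ?c = "real N powr p * real N"
  have "2 * energy cell p (level G n) f = (\<Sum>e\<in>touching_pairs cell (level G n). d e)"
    by (simp add: energy_eq d_def)
  also have "touching_pairs cell (level G n) = (SIGMA u:level G n. {v \<in> level G n. touching cell u v})"
    by (auto simp: touching_pairs_def)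
  also have "(\<Sum>e\<in>\<dots>. d e) = (\<Sum>u\<in>level G n. \<Sum>v | v \<in> level G n \<and> touching cell u v. d (u, v))"
    using finite_level by (subst sum.Sigma) (auto simp: case_prod_beta)
  also have "\<dots> \<le> (\<Sum>u\<in>level G n. real L * (?c * T u))"
  proof (rule sum_mono)
    fix u assume u: "u \<in> level G n"
    have "(\<Sum>v | v \<in> level G n \<and> touching cell u v. d (u, v))
        \<le> real (card {v \<in> level G n. touching cell u v}) * (?c * T u)"
      using edge u by (intro sum_bounded_above) auto
    also have "\<dots> \<le> real L * (?c * T u)"
      using overlap[OF u] T0 by (intro mult_right_mono) auto
    finally show "(\<Sum>v | v \<in> level G n \<and> touching cell u v. d (u, v)) \<le> real L * (?c * T u)" .
  qed
  also have "\<dots> = real L * ?c * (\<Sum>u\<in>level G n. T u)"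
    by (simp add: sum_distrib_left mult.assoc)
  \<comment> \<open>After the exchange of sums an edge is counted once for each \<open>u\<close>
    whose \<open>N\<close>-neighborhood contains its first vertex. There are at most
    \<open>L ^ N\<close> such \<open>u\<close>; the remaining factor \<open>L\<close> counts the
    partners \<open>v\<close> of \<open>u\<close>.\<close>
  also have "(\<Sum>u\<in>level G n. T u) = (\<Sum>X\<in>\<G>. \<Sum>e\<in>touching_pairs cell X. \<Sum>u\<in>level G n.
      if fst e \<in> neighborhood G cell N u then d e else 0)"
    unfolding T_def by (subst sum.swap, intro sum.cong refl, rule sum.swap)
  also have "\<dots> \<le> (\<Sum>X\<in>\<G>. \<Sum>e\<in>touching_pairs cell X. real L ^ N * d e)"
  proof (intro sum_mono)
    fix X e assume "X \<in> \<G>" "e \<in> touching_pairs cell X"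
    then have e: "fst e \<in> level G n" using sub[of X] by (auto simp: touching_pairs_def)
    have "(\<Sum>u\<in>level G n. if fst e \<in> neighborhood G cell N u then d e else 0)
        = real (card {u \<in> level G n. fst e \<in> neighborhood G cell N u}) * d e"
      by (simp add: sum.If_cases finite_level Int_def)
    then show "(\<Sum>u\<in>level G n. if fst e \<in> neighborhood G cell N u then d e else 0) \<le> real L ^ N * d e"
      using card_nb[OF e] d0 by (simp add: mult_right_mono)
  qed
  also have "\<dots> = real L ^ N * (2 * (\<Sum>X\<in>\<G>. energy cell p X f))"
    by (simp add: energy_eq d_def sum_distrib_left)
  finally have "2 * energy cell p (level G n) f
      \<le> real L * ?c * (real L ^ N * (2 * (\<Sum>X\<in>\<G>. energy cell p X f)))"
    by (simp add: mult_left_mono)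
  then show ?thesis by (simp add: mult_ac)
qed

text \<open>If an edge of level \<open>n + m\<close> lies among the descendants of \<open>X\<close>,
  the ancestor of its first vertex lies in \<open>X\<close>; so at most \<open>N\<^sub>T\<close>
  members of the cover count that edge.\<close>

lemma sum_energy_descendants_le:
  assumes cov: "is_covering G cell N\<^sub>T N (level G n) \<G> (\<lambda>X. X)"
  shows "(\<Sum>X\<in>\<G>. energy cell p (descendants_of G m X) f) \<le> real N\<^sub>T * energy cell p (level G (n + m)) f"
proof -
  define d where "d = (\<lambda>(a, b). \<bar>f a - f b\<bar> powr p)"
  have d0: "0 \<le> d e" for e by (simp add: d_def split: prod.split)
  let ?P = "\<lambda>X. touching_pairs cell (descendants_of G m X)"
  let ?Q = "touching_pairs cell (level G (n + m))"
  have fin: "finite \<G>" and sub: "\<And>X. X \<in> \<G> \<Longrightarrow> X \<subseteq> level G n"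
    using covering_members[OF cov] by blast+
  have finQ: "finite ?Q" by (intro finite_touching_pairs finite_level)
  have PQ: "?P X \<subseteq> ?Q" if "X \<in> \<G>" for X
    using sub[OF that] by (intro touching_pairs_mono) (auto simp: descendants_of_eq)
  have "2 * (\<Sum>X\<in>\<G>. energy cell p (descendants_of G m X) f) = (\<Sum>X\<in>\<G>. \<Sum>e\<in>?P X. d e)"
    by (simp add: energy_eq d_def sum_distrib_left)
  also have "\<dots> = (\<Sum>X\<in>\<G>. \<Sum>e\<in>?Q. if e \<in> ?P X then d e else 0)"
  proof (rule sum.cong[OF refl])
    fix X assume "X \<in> \<G>"
    then have "?Q \<inter> ?P X = ?P X" using PQ by blast
    then show "(\<Sum>e\<in>?P X. d e) = (\<Sum>e\<in>?Q. if e \<in> ?P X then d e else 0)"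
      using finQ by (simp flip: sum.inter_restrict)
  qed
  also have "\<dots> = (\<Sum>e\<in>?Q. \<Sum>X\<in>\<G>. if e \<in> ?P X then d e else 0)"
    by (rule sum.swap)
  also have "\<dots> \<le> (\<Sum>e\<in>?Q. real N\<^sub>T * d e)"
  proof (rule sum_mono)
    fix e assume e: "e \<in> ?Q"
    define w where "w = (parent G ^^ m) (fst e)"
    have w: "w \<in> level G n" using e by (auto simp: w_def touching_pairs_def ancestor_level)
    have "{X \<in> \<G>. e \<in> ?P X} \<subseteq> {X \<in> \<G>. w \<in> X}"
      using descendants_of_eq[OF sub, of _ m] by (auto simp: touching_pairs_def w_def)
    then have "card {X \<in> \<G>. e \<in> ?P X} \<le> card {X \<in> \<G>. w \<in> X}"
      using fin by (intro card_mono) auto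
    also have "\<dots> \<le> N\<^sub>T" using covering_members(3)[OF cov w] .
    finally have "real (card {X \<in> \<G>. e \<in> ?P X}) * d e \<le> real N\<^sub>T * d e"
      using d0 by (intro mult_right_mono) auto
    then show "(\<Sum>X\<in>\<G>. if e \<in> ?P X then d e else 0) \<le> real N\<^sub>T * d e"
      using fin by (simp add: sum.If_cases Int_def)
  qed
  also have "\<dots> = 2 * (real N\<^sub>T * energy cell p (level G (n + m)) f)"
    by (simp add: energy_eq d_def sum_distrib_left)
  finally show ?thesis by simp
qed

text \<open>The strict inequality provides an admissible function without any discussion of
  minimisers. Truncation to the unit interval is a contraction fixing 0 and 1, so it does not
  increase the energy.\<close>

lemma conductance_cutoff:
  assumes w: "w \<in> level G n" and p: "0 \<le> p"
    and bound: "conductance G cell p m n {w} (level G n - neighborhood G cell M w) < C"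
  obtains h where "\<And>v. 0 \<le> h v" "\<And>v. h v \<le> 1"
    "\<And>v. v \<in> level G (n + m) \<Longrightarrow> (parent G ^^ m) v = w \<Longrightarrow> h v = 1"
    "\<And>v. v \<in> level G (n + m) \<Longrightarrow> (parent G ^^ m) v \<notin> neighborhood G cell M w \<Longrightarrow> h v = 0"
    "energy cell p (level G (n + m)) h \<le> C"
proof -
  let ?A = "level G n - neighborhood G cell M w"
  let ?S = "{energy cell p (level G (n + m)) f | f.
    (\<forall>v\<in>descendants_of G m {w}. f v = 1) \<and> (\<forall>v\<in>descendants_of G m ?A. f v = 0)}"
  have D1: "descendants_of G m {w} = {v \<in> level G (n + m). (parent G ^^ m) v = w}"
    using descendants_of_eq[of "{w}" n m] w by auto
  have D0: "descendants_of G m ?A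
      = {v \<in> level G (n + m). (parent G ^^ m) v \<notin> neighborhood G cell M w}"
    using descendants_of_eq[of ?A n m] ancestor_level by auto
  \<comment> \<open>The indicator of the descendants of \<open>w\<close> is admissible, so the
    infimum is over a nonempty set.\<close>
  have "energy cell p (level G (n + m)) (\<lambda>v. if (parent G ^^ m) v = w then 1 else 0) \<in> ?S"
    using neighborhood_self[OF level_verts[OF w]] unfolding D1 D0
    by (intro CollectI exI conjI refl) auto
  then obtain y where "y \<in> ?S" "y < C"
    using bound cInf_lessD[of ?S C] unfolding conductance_def by blast
  then obtain f where f: "energy cell p (level G (n + m)) f < C"
    "\<And>v. v \<in> descendants_of G m {w} \<Longrightarrow> f v = 1" "\<And>v. v \<in> descendants_of G m ?A \<Longrightarrow> f v = 0"
    by blast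
  define h where "h v = max 0 (min 1 (f v))" for v
  have "energy cell p (level G (n + m)) h \<le> energy cell p (level G (n + m)) f"
    using p by (intro energy_mono) (auto simp: h_def)
  moreover have "h v = 1" if "v \<in> level G (n + m)" "(parent G ^^ m) v = w" for v
    using f(2)[of v] that by (simp add: D1 h_def)
  moreover have "h v = 0"
    if "v \<in> level G (n + m)" "(parent G ^^ m) v \<notin> neighborhood G cell M w" for v
    using f(3)[of v] that by (simp add: D0 h_def)
  ultimately show ?thesis using f(1) by (intro that[of h]) (auto simp: h_def)
qed

text \<open>The capped sum of the cutoffs of all vertices in the \<open>M\<close>-neighborhood is 1
  below each of them, at the price of a support of radius \<open>2 * M\<close>. Of the two factors
  \<open>L ^ M\<close>, one comes from the power of a sum and the other from the number of
  summands.\<close>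

lemma neighborhood_cutoff:
  assumes w: "w \<in> level G n" and p: "0 \<le> p" and C: "0 \<le> C"
    and bound: "\<And>v. v \<in> level G n \<Longrightarrow>
      conductance G cell p m n {v} (level G n - neighborhood G cell M v) < C"
  obtains h where "\<And>v. 0 \<le> h v" "\<And>v. h v \<le> 1"
    "\<And>v. v \<in> level G (n + m) \<Longrightarrow> (parent G ^^ m) v \<in> neighborhood G cell M w \<Longrightarrow> h v = 1"
    "\<And>v. v \<in> level G (n + m) \<Longrightarrow> (parent G ^^ m) v \<notin> neighborhood G cell (2 * M) w \<Longrightarrow> h v = 0"
    "energy cell p (level G (n + m)) h \<le> real (L ^ M) powr p * (real (L ^ M) * C)"
proof -
  let ?N = "neighborhood G cell M w"
  have "\<forall>u\<in>level G n. \<exists>h. (\<forall>v. 0 \<le> h v \<and> h v \<le> 1) \<and>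
      (\<forall>v\<in>level G (n + m). (parent G ^^ m) v = u \<longrightarrow> h v = 1) \<and>
      (\<forall>v\<in>level G (n + m). (parent G ^^ m) v \<notin> neighborhood G cell M u \<longrightarrow> h v = (0::real)) \<and>
      energy cell p (level G (n + m)) h \<le> C"
    using conductance_cutoff[OF _ p bound] by metis
  from bchoice[OF this] obtain g where g_all: "\<forall>u\<in>level G n. (\<forall>v. 0 \<le> g u v \<and> g u v \<le> 1) \<and>
      (\<forall>v\<in>level G (n + m). (parent G ^^ m) v = u \<longrightarrow> g u v = 1) \<and>
      (\<forall>v\<in>level G (n + m). (parent G ^^ m) v \<notin> neighborhood G cell M u \<longrightarrow> g u v = (0::real)) \<and>
      energy cell p (level G (n + m)) (g u) \<le> C"
    by (elim exE)
  have g: "\<And>u v. u \<in> level G n \<Longrightarrow> 0 \<le> g u v" "\<And>u v. u \<in> level G n \<Longrightarrow> g u v \<le> (1::real)"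
    "\<And>u v. u \<in> level G n \<Longrightarrow> v \<in> level G (n + m) \<Longrightarrow> (parent G ^^ m) v = u \<Longrightarrow> g u v = 1"
    "\<And>u v. u \<in> level G n \<Longrightarrow> v \<in> level G (n + m) \<Longrightarrow>
      (parent G ^^ m) v \<notin> neighborhood G cell M u \<Longrightarrow> g u v = 0"
    "\<And>u. u \<in> level G n \<Longrightarrow> energy cell p (level G (n + m)) (g u) \<le> C"
    using g_all by blast+
  have lev: "u \<in> level G n" if "u \<in> ?N" for u using neighborhood_level[OF w that] .
  define h where "h v = min 1 (\<Sum>u\<in>?N. g u v)" for v
  have s0: "0 \<le> (\<Sum>u\<in>?N. g u v)" for v using g(1) lev by (intro sum_nonneg) auto
  have 1: "h v = 1" if v: "v \<in> level G (n + m)" "(parent G ^^ m) v \<in> ?N" for v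
  proof -
    have "1 = g ((parent G ^^ m) v) v" using g(3) v lev by simp
    also have "\<dots> \<le> (\<Sum>u\<in>?N. g u v)"
      using v g(1) lev finite_neighborhood by (intro member_le_sum) auto
    finally show ?thesis by (simp add: h_def)
  qed
  have 0: "h v = 0"
    if v: "v \<in> level G (n + m)" "(parent G ^^ m) v \<notin> neighborhood G cell (2 * M) w" for v
  proof -
    have "g u v = 0" if u: "u \<in> ?N" for u
      using g(4)[OF lev[OF u] v(1)] neighborhood_add[OF w u, of _ M] v(2) by (auto simp: mult_2)
    then show ?thesis by (simp add: h_def)
  qed
  have card: "real (card ?N) \<le> real (L ^ M)"
    using card_neighborhood[OF w] by (simp only: of_nat_le_iff)
  have "energy cell p (level G (n + m)) h
      \<le> (\<Sum>u\<in>?N. real (card ?N) powr p * energy cell p (level G (n + m)) (g u))"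
  proof (rule energy_le_sum)
    fix u v
    have "\<bar>h u - h v\<bar> \<le> \<bar>\<Sum>i\<in>?N. g i u - g i v\<bar>"
      by (auto simp: h_def sum_subtractf)
    then have "\<bar>h u - h v\<bar> powr p \<le> \<bar>\<Sum>i\<in>?N. g i u - g i v\<bar> powr p"
      using p by (intro powr_mono2) auto
    also have "\<dots> \<le> (\<Sum>i\<in>?N. real (card ?N) powr p * \<bar>g i u - g i v\<bar> powr p)"
      using abs_sum_powr_le[OF finite_neighborhood p] by (simp add: sum_distrib_left)
    finally show "\<bar>h u - h v\<bar> powr p \<le> (\<Sum>i\<in>?N. real (card ?N) powr p * \<bar>g i u - g i v\<bar> powr p)" .
  qed
  also have "\<dots> = real (card ?N) powr p * (\<Sum>u\<in>?N. energy cell p (level G (n + m)) (g u))"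
    by (simp add: sum_distrib_left)
  also have "\<dots> \<le> real (L ^ M) powr p * (real (L ^ M) * C)"
  proof (intro mult_mono powr_mono2 card p)
    have "(\<Sum>u\<in>?N. energy cell p (level G (n + m)) (g u)) \<le> real (card ?N) * C"
      using g(5) lev by (intro sum_bounded_above) auto
    also have "\<dots> \<le> real (L ^ M) * C" using card C by (intro mult_right_mono)
    finally show "(\<Sum>u\<in>?N. energy cell p (level G (n + m)) (g u)) \<le> real (L ^ M) * C" .
  qed (auto intro!: sum_nonneg energy_nonneg)
  finally show ?thesis using that[of h] 0 1 s0 by (auto simp: h_def)
qed

end

section \<open>Energies of averages under the disparity bound\<close>

context measured_tree
begin

lemma energy_le_of_disparity:
  assumes disp: "neighbor_disparity G cell \<mu> p m A \<le> ennreal c" and c: "0 \<le> c"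
    and f: "integrable \<mu> f"
  shows "energy cell p A (cell_average \<mu> cell f)
    \<le> c * energy cell p (descendants_of G m A) (cell_average \<mu> cell f)"
proof -
  let ?a = "energy cell p A (cell_average \<mu> cell f)"
  let ?b = "energy cell p (descendants_of G m A) (cell_average \<mu> cell f)"
  have "ennreal ?a / ennreal ?b \<le> neighbor_disparity G cell \<mu> p m A"
    unfolding neighbor_disparity_def using f by (intro SUP_upper) simp
  then have le: "ennreal ?a / ennreal ?b \<le> ennreal c" using disp by (rule order.trans)
  show ?thesis
  proof (cases "?b = 0")
    \<comment> \<open>A positive number divided by 0 is infinite, so the finite bound forces the
      numerator to vanish together with the denominator.\<close>
    case True
    have "?a = 0"
    proof (rule ccontr)
      assume "?a \<noteq> 0"
      then have "0 < ?a" using energy_nonneg[of cell p A "cell_average \<mu> cell f"] by linarith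
      then have "ennreal ?a / ennreal ?b = \<top>"
        using True by (simp add: ennreal_divide_eq_top_iff)
      then show False using le by (simp add: top_unique)
    qed
    then show ?thesis using True by simp
  next
    case False
    then have b: "0 < ?b" using energy_nonneg[of cell p _ "cell_average \<mu> cell f"] by (metis order_le_less)
    then have "ennreal (?a / ?b) \<le> ennreal c"
      using le divide_ennreal[OF energy_nonneg[of cell p A "cell_average \<mu> cell f"] b] by simp
    then have "?a / ?b \<le> c" using c by (simp add: ennreal_le_iff)
    then show ?thesis using b by (simp add: field_simps)
  qed
qed

text \<open>Level \<open>n\<close> is the generation \<open>n\<close> below the base, so for
  \<open>1 \<le> n\<close> the covering system contains a cover of it. Disparity compares the
  energies member by member; the chains of the cover and the overlap number \<open>N\<^sub>T\<close>
  turn this into a comparison of whole levels.\<close>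

lemma energy_average_le:
  assumes covering: "covering_system G cell N\<^sub>T N \<I>" and p: "0 \<le> p" and n: "1 \<le> n" and c: "0 \<le> c"
    and disp: "neighbor_disparity_const G cell \<mu> \<I> p m n \<le> ennreal c"
  shows "energy cell p (level G n) (average m F)
    \<le> real N powr p * real N * real L ^ (N + 1) * real N\<^sub>T * c * energy cell p (level G (n + m)) F"
proof -
  obtain \<G> where \<G>: "\<G> \<subseteq> \<I>" "is_covering G cell N\<^sub>T N (level G n) \<G> (\<lambda>X. X)"
    using covering n unfolding covering_system_def level_eq_descendants by (meson base_in_verts)
  let ?C = "real N powr p * real N * real L ^ (N + 1)"
  \<comment> \<open>Disparity is a supremum over integrable functions on \<open>K\<close>, so
    \<open>F\<close> has to be realised as one; its averages on level \<open>n + m\<close> are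
    \<open>F\<close> again.\<close>
  let ?f = "step (n + m) F"
  have sub: "X \<subseteq> level G n" if "X \<in> \<G>" for X
    by (rule covering_members(2)[OF \<G>(2) that])
  have "energy cell p X (cell_average \<mu> cell ?f)
      \<le> c * energy cell p (descendants_of G m X) (cell_average \<mu> cell ?f)" if X: "X \<in> \<G>" for X
  proof (rule energy_le_of_disparity[OF _ c integrable_step])
    have "neighbor_disparity G cell \<mu> p m X \<le> neighbor_disparity_const G cell \<mu> \<I> p m n"
      unfolding neighbor_disparity_const_def using \<G>(1) X sub by (intro SUP_upper) auto
    then show "neighbor_disparity G cell \<mu> p m X \<le> ennreal c" using disp by (rule order.trans)
  qed
  then have "(\<Sum>X\<in>\<G>. energy cell p X (cell_average \<mu> cell ?f))
      \<le> c * (\<Sum>X\<in>\<G>. energy cell p (descendants_of G m X) (cell_average \<mu> cell ?f))"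
    unfolding sum_distrib_left by (rule sum_mono)
  also have "\<dots> \<le> c * (real N\<^sub>T * energy cell p (level G (n + m)) (cell_average \<mu> cell ?f))"
    using c by (intro mult_left_mono sum_energy_descendants_le[OF \<G>(2)])
  also have "energy cell p (level G (n + m)) (cell_average \<mu> cell ?f) = energy cell p (level G (n + m)) F"
    using cell_average_step[of _ "n + m" 0 F] average_0 level_verts by (intro energy_cong) force
  finally have le: "(\<Sum>X\<in>\<G>. energy cell p X (cell_average \<mu> cell ?f))
      \<le> c * (real N\<^sub>T * energy cell p (level G (n + m)) F)" .
  have "energy cell p (level G n) (average m F) = energy cell p (level G n) (cell_average \<mu> cell ?f)"
    by (intro energy_cong) (simp add: cell_average_step)
  also have "\<dots> \<le> ?C * (\<Sum>X\<in>\<G>. energy cell p X (cell_average \<mu> cell ?f))"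
    by (rule energy_le_covering[OF \<G>(2) p])
  also have "\<dots> \<le> ?C * (c * (real N\<^sub>T * energy cell p (level G (n + m)) F))"
    using le by (intro mult_left_mono) auto
  finally show ?thesis by (simp add: mult_ac)
qed

end

section \<open>The cascade of cutoff functions\<close>

lemma summable_powr_times_power:
  fixes g q :: real
  assumes "0 < g" "g < 1"
  shows "summable (\<lambda>k. real (Suc k) powr q * g ^ k)"
proof -
  have "(\<lambda>k. (real (Suc (Suc k)) / real (Suc k)) powr q * g) \<longlonglongrightarrow> 1 powr q * g"
    by (intro tendsto_mult tendsto_powr tendsto_const) (real_asymp, simp)
  \<comment> \<open>The quotients of successive terms tend to \<open>g\<close>, and
    \<open>(1 + g) / 2\<close> lies strictly between \<open>g\<close> and 1.\<close>
  then have "eventually (\<lambda>k. (real (Suc (Suc k)) / real (Suc k)) powr q * g < (1 + g) / 2) sequentially"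
    using assms by (intro order_tendstoD) auto
  then obtain N where N: "\<And>k. N \<le> k \<Longrightarrow> (real (Suc (Suc k)) / real (Suc k)) powr q * g < (1 + g) / 2"
    by (auto simp: eventually_sequentially)
  show ?thesis
  proof (rule summable_ratio_test[of "(1 + g) / 2" N])
    fix k assume "N \<le> k"
    have "real (Suc (Suc k)) powr q * g ^ Suc k
        = (real (Suc (Suc k)) / real (Suc k)) powr q * g * (real (Suc k) powr q * g ^ k)"
      by (simp add: powr_divide del: of_nat_Suc)
    also have "\<dots> \<le> (1 + g) / 2 * (real (Suc k) powr q * g ^ k)"
      using N[OF \<open>N \<le> k\<close>] assms by (intro mult_right_mono) auto
    finally show "norm (real (Suc (Suc k)) powr q * g ^ Suc k) \<le> (1 + g) / 2 * norm (real (Suc k) powr q * g ^ k)"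
      using assms by simp
  qed (use assms in simp)
qed

lemma diagonal_convergent:
  fixes x :: "nat \<Rightarrow> 'v \<Rightarrow> real"
  assumes "countable S" and bound: "\<And>v. v \<in> S \<Longrightarrow> \<exists>B. \<forall>n. \<bar>x n v\<bar> \<le> B"
  obtains d where "strict_mono d" "\<And>v. v \<in> S \<Longrightarrow> convergent (\<lambda>i. x (d i) v)"
proof -
  \<comment> \<open>The guard covers the empty set, which has no enumeration.\<close>
  define P :: "nat \<Rightarrow> (nat \<Rightarrow> nat) \<Rightarrow> bool"
    where "P n s \<longleftrightarrow> (S \<noteq> {} \<longrightarrow> convergent (\<lambda>i. x (s i) (from_nat_into S n)))" for n s
  have ex: "\<exists>r. strict_mono r \<and> P n (s \<circ> r)" for n and s :: "nat \<Rightarrow> nat"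
  proof (cases "S = {}")
    case False
    then have "from_nat_into S n \<in> S" by (rule from_nat_into)
    then obtain B where B: "\<And>i. \<bar>x (s i) (from_nat_into S n)\<bar> \<le> B" using bound by blast
    then have "bounded (range (\<lambda>i. x (s i) (from_nat_into S n)))"
      by (auto simp: bounded_iff)
    from bounded_imp_convergent_subsequence[OF this] show ?thesis
      unfolding P_def o_def by (metis convergentI)
  qed (auto simp: P_def intro: strict_mono_id exI[of _ id])
  interpret subseqs P
    by unfold_locales (rule ex)
  \<comment> \<open>The diagonal sequence refines the stage that settles the index \<open>k\<close>
    only from position \<open>Suc k\<close> on; the shift is removed later, as convergence ignores
    initial segments.\<close>
  have hold: "P k (diagseq \<circ> (+) (Suc k))" for k
  proof (rule diagseq_holds)
    fix t s :: "nat \<Rightarrow> nat" and n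
    assume t: "strict_mono t" and P: "P n s"
    show "P n (s \<circ> t)"
      unfolding P_def
    proof
      assume "S \<noteq> {}"
      then have "convergent (\<lambda>i. x (s i) (from_nat_into S n))" using P unfolding P_def by blast
      from convergent_subseq_convergent[OF this t]
      show "convergent (\<lambda>i. x ((s \<circ> t) i) (from_nat_into S n))" by (simp only: o_def)
    qed
  qed
  show ?thesis
  proof (rule that[OF subseq_diagseq])
    fix v assume v: "v \<in> S"
    then obtain k where k: "from_nat_into S k = v"
      using assms(1) from_nat_into_surj by metis
    have "S \<noteq> {}" using v by blast
    then have "convergent (\<lambda>i. x ((diagseq \<circ> (+) (Suc k)) i) v)"
      using hold[of k] unfolding P_def k by (rule mp[rotated])
    then have "convergent (\<lambda>i. x (diagseq (i + Suc k)) v)"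
      by (simp only: o_def add.commute)
    then show "convergent (\<lambda>i. x (diagseq i) v)"
      using convergent_ignore_initial_segment[of "\<lambda>i. x (diagseq i) v" "Suc k"] by simp
  qed
qed

text \<open>\<open>h k\<close> is a cutoff function around the vertex of level \<open>k * (M + 1)\<close> of the ray \<open>r\<close>,
  discretised at level \<open>N\<close>.\<close>

definition cutoffs ::
  "'t rooted_graph \<Rightarrow> ('t \<Rightarrow> 'a set) \<Rightarrow> nat \<Rightarrow> (nat \<Rightarrow> 't) \<Rightarrow> nat \<Rightarrow> (nat \<Rightarrow> 't \<Rightarrow> real) \<Rightarrow> bool" where
  "cutoffs G cell M r N h \<longleftrightarrow> (\<forall>k v. k * (M + 1) \<le> N \<longrightarrow> v \<in> level G N \<longrightarrow>
     0 \<le> h k v \<and> h k v \<le> 1 \<and>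
     ((parent G ^^ (N - k * (M + 1))) v \<in> neighborhood G cell M (r (k * (M + 1))) \<longrightarrow> h k v = 1) \<and>
     ((parent G ^^ (N - k * (M + 1))) v \<notin> neighborhood G cell (2 * M) (r (k * (M + 1))) \<longrightarrow> h k v = 0))"

definition cutoff_sum :: "nat \<Rightarrow> nat \<Rightarrow> (nat \<Rightarrow> 't \<Rightarrow> real) \<Rightarrow> 't \<Rightarrow> real" where
  "cutoff_sum M N h v = (\<Sum>k | k * (M + 1) \<le> N. 1 / real (Suc k) * h k v)"

lemma finite_multiples_le [simp]: "finite {k::nat. k + k * M \<le> N}"
  by (rule finite_subset[of _ "{..N}"]) auto

section \<open>Cutoffs along a ray, and the energy of their weighted sum\<close>

context tree_cells
begin

lemma ray_exists:
  obtains r where "\<And>n. r n \<in> level G n" "\<And>n. parent G (r (Suc n)) = r n"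
proof -
  have "\<exists>r. \<forall>n. r n \<in> level G n \<and> parent G (r (Suc n)) = r n"
  proof (rule dependent_nat_choice)
    fix w n assume w: "w \<in> level G n"
    then have "children G w \<noteq> {}" using children_nonempty level_verts by blast
    then show "\<exists>v. v \<in> level G (Suc n) \<and> parent G v = w"
      by (auto simp: children_eq[OF w])
  qed (simp add: level_0)
  then show ?thesis using that by blast
qed

lemma ray_ancestor:
  assumes "\<And>n. parent G (r (Suc n)) = r n"
  shows "(parent G ^^ m) (r (n + m)) = r n"
  by (induction m) (simp_all add: funpow_swap1 assms)

text \<open>With \<open>m = N - n\<close> the conductance bound contributes \<sigma>^(-m);
  multiplying by \<sigma>^N leaves \<sigma>^n, which no longer depends on the discretisation
  level.\<close>

lemma cutoffs_exist:
  assumes r: "\<And>n. r n \<in> level G n" and p: "0 \<le> p" and c: "0 < c" and \<sigma>: "0 < \<sigma>"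
    and cond: "\<And>m w. w \<in> verts G \<Longrightarrow> conductance G cell p m (depth G w) {w}
      (level G (depth G w) - neighborhood G cell M w) \<le> c * \<sigma> powi (- int m)"
  obtains h where "\<And>N. cutoffs G cell M r N (h N)"
    "\<And>N k. k * (M + 1) \<le> N \<Longrightarrow> \<sigma> ^ N * energy cell p (level G N) (h N k)
      \<le> real (L ^ M) powr p * real (L ^ M) * (2 * c) * \<sigma> ^ (k * (M + 1))"
proof -
  let ?A = "real (L ^ M) powr p * real (L ^ M) * (2 * c)"
  define good where "good N k g \<longleftrightarrow> (\<forall>v\<in>level G N. 0 \<le> g v \<and> g v \<le> (1::real) \<and>
     ((parent G ^^ (N - k * (M + 1))) v \<in> neighborhood G cell M (r (k * (M + 1))) \<longrightarrow> g v = 1) \<and>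
     ((parent G ^^ (N - k * (M + 1))) v \<notin> neighborhood G cell (2 * M) (r (k * (M + 1))) \<longrightarrow> g v = 0)) \<and>
     \<sigma> ^ N * energy cell p (level G N) g \<le> ?A * \<sigma> ^ (k * (M + 1))" for N k g
  have ex: "\<exists>g. k * (M + 1) \<le> N \<longrightarrow> good N k g" for N k
  proof (cases "k * (M + 1) \<le> N")
    case True
    define n where "n = k * (M + 1)"
    define m where "m = N - n"
    have N: "N = n + m" using True by (simp add: n_def m_def)
    have "conductance G cell p m n {v} (level G n - neighborhood G cell M v) < 2 * c / \<sigma> ^ m"
      if v: "v \<in> level G n" for v
    proof -
      have "conductance G cell p m n {v} (level G n - neighborhood G cell M v) \<le> c / \<sigma> ^ m"
        using cond[OF level_verts[OF v], of m] by (simp add: level_depth[OF v] power_int_minus field_simps)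
      \<comment> \<open>Doubling \<open>c\<close> creates the strict inequality by which a
        near-optimal function is selected.\<close>
      also have "\<dots> < 2 * c / \<sigma> ^ m" using c \<sigma> by (intro divide_strict_right_mono) auto
      finally show ?thesis .
    qed
    then obtain g where g: "\<And>v. 0 \<le> g v" "\<And>v. g v \<le> 1"
      "\<And>v. v \<in> level G (n + m) \<Longrightarrow> (parent G ^^ m) v \<in> neighborhood G cell M (r n) \<Longrightarrow> g v = 1"
      "\<And>v. v \<in> level G (n + m) \<Longrightarrow> (parent G ^^ m) v \<notin> neighborhood G cell (2 * M) (r n) \<Longrightarrow> g v = 0"
      "energy cell p (level G (n + m)) g \<le> real (L ^ M) powr p * (real (L ^ M) * (2 * c / \<sigma> ^ m))"
      using neighborhood_cutoff[OF r[of n] p, of "2 * c / \<sigma> ^ m" m M] c \<sigma> by (auto simp: less_imp_le)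
    have "\<sigma> ^ N * energy cell p (level G N) g
        \<le> \<sigma> ^ N * (real (L ^ M) powr p * (real (L ^ M) * (2 * c / \<sigma> ^ m)))"
      using g(5) \<sigma> unfolding N by (intro mult_left_mono) auto
    also have "\<dots> = ?A * \<sigma> ^ n" using \<sigma> by (simp add: N power_add)
    finally have "good N k g"
      using g(1-4) unfolding good_def N by (simp add: n_def)
    then show ?thesis by blast
  qed simp
  have "\<exists>h. \<forall>N k. k * (M + 1) \<le> N \<longrightarrow> good N k (h N k)"
    by (intro choice allI ex)
  then obtain h where h: "\<And>N k. k * (M + 1) \<le> N \<Longrightarrow> good N k (h N k)" by blast
  show ?thesis
  proof (rule that[of h])
    show "cutoffs G cell M r N (h N)" for N
      using h[of _ N] unfolding good_def cutoffs_def by blast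
    show "\<sigma> ^ N * energy cell p (level G N) (h N k) \<le> ?A * \<sigma> ^ (k * (M + 1))"
      if "k * (M + 1) \<le> N" for N k
      using h[OF that] unfolding good_def by blast
  qed
qed

text \<open>The regions where the cutoff functions are not locally constant are disjoint: near the
  support of \<open>h k\<close> all \<open>h j\<close> with \<open>j < k\<close> are equal to one.\<close>

lemma cutoffs_separated:
  assumes h: "cutoffs G cell M r N h"
    and r: "\<And>n. r n \<in> level G n" "\<And>n. parent G (r (Suc n)) = r n"
    and M: "\<And>w. w \<in> verts G \<Longrightarrow>
      parent G ` neighborhood G cell (M + 1) w \<subseteq> neighborhood G cell M (parent G w)"
    and uv: "u \<in> level G N" "v \<in> level G N" "touching cell u v"
    and jk: "j < k" "k * (M + 1) \<le> N" and ne: "h k u \<noteq> h k v"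
  shows "h j u = h j v"
proof -
  define n where "n = k * (M + 1)"
  define i where "i = (k - j) * (M + 1)"
  define l where "l = j * (M + 1)"
  have n: "n = l + i" "n \<le> N" "M + 1 \<le> i"
    using jk by (auto simp: n_def l_def i_def simp flip: add_mult_distrib) (cases "k - j"; simp)
  have lN: "l \<le> N" "N - l = i + (N - n)" using n by auto
  let ?a = "parent G ^^ (N - n)"
  have alev: "?a u \<in> level G n" "?a v \<in> level G n"
    using ancestor_level[of _ n "N - n"] uv n by auto
  have touch: "touching cell (?a u) (?a v)"
    using touching_ancestor uv level_verts by blast
  have touch': "touching cell (?a v) (?a u)" using touching_sym[OF touch] .
  have far: "?a u \<in> neighborhood G cell (2 * M) (r n) \<or> ?a v \<in> neighborhood G cell (2 * M) (r n)"
    using h ne uv n unfolding cutoffs_def n_def by metis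
  have near: "?a x \<in> neighborhood G cell (Suc (2 * M)) (r n)" if "x \<in> {u, v}" for x
    using far that alev touch touch' touching_self[OF level_verts[OF alev(1)]]
      touching_self[OF level_verts[OF alev(2)]]
    unfolding neighborhood_Suc[OF r(1)] by blast
  have "h j x = 1" if x: "x \<in> {u, v}" for x
  proof -
    \<comment> \<open>This is where the spacing enters: \<open>M + 1 \<le> i\<close> gives
      \<open>2 * M + 1 \<le> M + i\<close>, so \<open>i\<close> generations reduce the radius to
      \<open>M\<close>, where \<open>h j\<close> equals 1.\<close>
    have "?a x \<in> neighborhood G cell (M + i) (r n)"
      using near[OF x] neighborhood_mono[OF level_verts[OF r(1)], of "Suc (2 * M)" "M + i" n] n by auto
    moreover have "r n \<in> level G (l + i)" using r(1)[of n] n by simp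
    ultimately have "(parent G ^^ i) (?a x) \<in> neighborhood G cell M ((parent G ^^ i) (r n))"
      using ancestor_neighborhood[OF M] by blast
    also have "(parent G ^^ i) (r n) = r l"
      using ray_ancestor[of r i l] r(2) n by simp
    also have "(parent G ^^ i) (?a x) = (parent G ^^ (N - l)) x"
      unfolding lN by (simp add: funpow_add)
    finally show "h j x = 1"
      using h x uv lN unfolding cutoffs_def l_def by blast
  qed
  then show ?thesis by simp
qed

text \<open>Across any one edge at most one cutoff varies. The power of the sum is then the power of
  a single term, and no factor depending on the number of cutoffs arises.\<close>

lemma energy_cutoff_sum_le:
  assumes h: "cutoffs G cell M r N h"
    and r: "\<And>n. r n \<in> level G n" "\<And>n. parent G (r (Suc n)) = r n"
    and M: "\<And>w. w \<in> verts G \<Longrightarrow>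
      parent G ` neighborhood G cell (M + 1) w \<subseteq> neighborhood G cell M (parent G w)"
    and p: "0 \<le> p"
  shows "energy cell p (level G N) (cutoff_sum M N h)
    \<le> (\<Sum>k | k * (M + 1) \<le> N. (1 / real (Suc k)) powr p * energy cell p (level G N) (h k))"
proof (rule energy_le_sum)
  fix u v assume uv: "u \<in> level G N" "v \<in> level G N" "touching cell u v"
  let ?I = "{k. k * (M + 1) \<le> N}"
  let ?t = "\<lambda>k. 1 / real (Suc k) * (h k u - h k v)"
  have fin: "finite ?I" by simp
  have diff: "cutoff_sum M N h u - cutoff_sum M N h v = (\<Sum>k\<in>?I. ?t k)"
    by (simp add: cutoff_sum_def algebra_simps sum_subtractf diff_divide_distrib)
  have nonneg: "0 \<le> (\<Sum>k\<in>?I. (1 / real (Suc k)) powr p * \<bar>h k u - h k v\<bar> powr p)"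
    by (intro sum_nonneg) auto
  show "\<bar>cutoff_sum M N h u - cutoff_sum M N h v\<bar> powr p
      \<le> (\<Sum>k\<in>?I. (1 / real (Suc k)) powr p * \<bar>h k u - h k v\<bar> powr p)"
  proof (cases "\<exists>k\<in>?I. h k u \<noteq> h k v")
    case False
    then have "(\<Sum>k\<in>?I. ?t k) = 0" by (intro sum.neutral) auto
    then show ?thesis unfolding diff using nonneg by simp
  next
    case True
    then obtain k where k: "k \<in> ?I" "h k u \<noteq> h k v" by blast
    have "h j u = h j v" if j: "j \<in> ?I" "j \<noteq> k" for j
    proof (cases "j < k")
      case True
      then show ?thesis using cutoffs_separated[OF h r M uv True] k by auto
    next
      case False
      then have "k < j" using j by simp
      \<comment> \<open>Used in contrapositive form: if \<open>h j\<close> varied across the edge,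
        \<open>h k\<close> would be constant there.\<close>
      then show ?thesis using cutoffs_separated[OF h r M uv \<open>k < j\<close>] k j by auto
    qed
    then have "(\<Sum>k\<in>?I. ?t k) = (\<Sum>j\<in>?I. if j = k then ?t k else 0)"
      by (intro sum.cong) auto
    then have "\<bar>\<Sum>k\<in>?I. ?t k\<bar> powr p = \<bar>?t k\<bar> powr p"
      using fin k(1) by simp
    also have "\<dots> = (1 / real (Suc k)) powr p * \<bar>h k u - h k v\<bar> powr p"
      by (simp add: abs_mult powr_divide del: of_nat_Suc)
    also have "\<dots> \<le> (\<Sum>k\<in>?I. (1 / real (Suc k)) powr p * \<bar>h k u - h k v\<bar> powr p)"
      using fin k(1) by (intro member_le_sum) auto
    finally show ?thesis unfolding diff .
  qed
qed

end

section \<open>Moments and lower bounds of the weighted sum, and the limit function\<close>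

context measured_tree
begin

text \<open>With all weights replaced by 1, the sum at \<open>v\<close> is at most the number of
  supports over \<open>v\<close>, hence at most one plus the largest index among them. This growth
  is polynomial in the index, while the mass of the support decays geometrically.\<close>

lemma moments_cutoff_sum_le:
  assumes h: "cutoffs G cell M r N h" and r: "\<And>n. r n \<in> level G n" and q: "1 \<le> q"
    and mass: "\<And>w. w \<in> verts G \<Longrightarrow> prob (cell w) \<le> b * \<gamma> ^ depth G w"
    and b: "0 \<le> b" and \<gamma>: "0 < \<gamma>" "\<gamma> < 1"
  shows "(\<Sum>v\<in>level G N. \<bar>cutoff_sum M N h v\<bar> powr q * prob (cell v))
    \<le> real (L ^ (2 * M)) * b * (\<Sum>k. real (Suc k) powr q * \<gamma> ^ k)"
proof -
  let ?I = "{k. k * (M + 1) \<le> N}"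
  let ?in = "\<lambda>k v. (parent G ^^ (N - k * (M + 1))) v \<in> neighborhood G cell (2 * M) (r (k * (M + 1)))"
  have fin: "finite ?I" by simp
  have pt: "\<bar>cutoff_sum M N h v\<bar> powr q \<le> (\<Sum>k\<in>?I. if ?in k v then real (Suc k) powr q else 0)"
    if v: "v \<in> level G N" for v
  proof -
    let ?S = "{k \<in> ?I. ?in k v}"
    have S: "finite ?S" using fin by simp
    have hk: "0 \<le> h k v" "h k v \<le> 1" "\<not> ?in k v \<Longrightarrow> h k v = 0" if "k \<in> ?I" for k
      using h v that unfolding cutoffs_def by blast+
    have le: "1 / real (Suc k) * h k v \<le> (if ?in k v then 1 else 0)" if "k \<in> ?I" for k
      using hk[OF that] by (auto simp: divide_simps)
    have "\<bar>cutoff_sum M N h v\<bar> = cutoff_sum M N h v"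
      unfolding cutoff_sum_def using hk by (intro abs_of_nonneg sum_nonneg) auto
    also have "\<dots> \<le> (\<Sum>k\<in>?I. if ?in k v then 1 else 0)"
      unfolding cutoff_sum_def using le by (rule sum_mono)
    also have "\<dots> = real (card ?S)"
      using fin by (simp add: sum.If_cases Int_def)
    finally have card: "\<bar>cutoff_sum M N h v\<bar> \<le> real (card ?S)" .
    have sumS: "(\<Sum>k\<in>?I. if ?in k v then real (Suc k) powr q else 0) = (\<Sum>k\<in>?S. real (Suc k) powr q)"
      by (rule sum.inter_filter[OF fin, symmetric])
    show ?thesis
    proof (cases "?S = {}")
      case True
      then show ?thesis using card sumS unfolding True by simp
    next
      case False
      have "?S \<subseteq> {..Max ?S}" using S by auto
      then have "card ?S \<le> Suc (Max ?S)" using card_mono[of "{..Max ?S}" ?S] by simp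
      then have "\<bar>cutoff_sum M N h v\<bar> \<le> real (Suc (Max ?S))" using card by simp
      then have "\<bar>cutoff_sum M N h v\<bar> powr q \<le> real (Suc (Max ?S)) powr q"
        using q by (intro powr_mono2) auto
      also have "\<dots> \<le> (\<Sum>k\<in>?S. real (Suc k) powr q)"
        using Max_in[OF S False] S by (intro member_le_sum) auto
      finally show ?thesis unfolding sumS .
    qed
  qed
  \<comment> \<open>The support consists of at most \<open>L ^ (2 * M)\<close> cells of level
    \<open>k * (M + 1)\<close>; since this level is at least \<open>k\<close>, each has mass at most
    \<open>b * \<gamma> ^ k\<close>.\<close>
  have shell: "(\<Sum>v\<in>level G N. if ?in k v then real (Suc k) powr q * prob (cell v) else 0)
      \<le> real (Suc k) powr q * (real (L ^ (2 * M)) * (b * \<gamma> ^ k))" if k: "k \<in> ?I" for k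
  proof -
    define n where "n = k * (M + 1)"
    define m where "m = N - n"
    have N: "N = n + m" using k by (simp add: n_def m_def)
    let ?N = "neighborhood G cell (2 * M) (r n)"
    have kn: "k \<le> n" by (simp add: n_def)
    have "(\<Sum>v\<in>level G (n + m). if (parent G ^^ m) v \<in> ?N then prob (cell v) else 0)
        = (\<Sum>w\<in>level G n. \<Sum>v\<in>descendants G m w. if (parent G ^^ m) v \<in> ?N then prob (cell v) else 0)"
      by (rule sum_level_descendants)
    also have "\<dots> = (\<Sum>w\<in>level G n. if w \<in> ?N then prob (cell w) else 0)"
    proof (rule sum.cong[OF refl])
      fix w assume w: "w \<in> level G n"
      have "(\<Sum>v\<in>descendants G m w. if (parent G ^^ m) v \<in> ?N then prob (cell v) else 0)
          = (\<Sum>v\<in>descendants G m w. if w \<in> ?N then prob (cell v) else 0)"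
        by (intro sum.cong) (auto simp: descendants_eq[OF w])
      then show "(\<Sum>v\<in>descendants G m w. if (parent G ^^ m) v \<in> ?N then prob (cell v) else 0)
          = (if w \<in> ?N then prob (cell w) else 0)"
        using prob_descendants[OF w, of m] by simp
    qed
    also have "\<dots> = (\<Sum>w\<in>level G n \<inter> ?N. prob (cell w))"
      using finite_level by (simp add: sum.inter_restrict)
    also have "level G n \<inter> ?N = ?N" using neighborhood_level[OF r] by blast
    also have "(\<Sum>w\<in>?N. prob (cell w)) \<le> real (card ?N) * (b * \<gamma> ^ n)"
      using mass neighborhood_level[OF r] level_verts level_depth by (intro sum_bounded_above) metis
    also have "\<dots> \<le> real (L ^ (2 * M)) * (b * \<gamma> ^ k)"
      using card_neighborhood[OF r, of "2 * M" n] b \<gamma> kn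
      by (intro mult_mono power_decreasing) (auto simp del: of_nat_power)
    finally have "real (Suc k) powr q * (\<Sum>v\<in>level G (n + m). if (parent G ^^ m) v \<in> ?N then prob (cell v) else 0)
      \<le> real (Suc k) powr q * (real (L ^ (2 * M)) * (b * \<gamma> ^ k))"
      by (intro mult_left_mono) auto
    then show ?thesis
      unfolding sum_distrib_left N by (simp add: n_def if_distrib cong: if_cong del: of_nat_Suc)
  qed
  have summable: "summable (\<lambda>k. real (Suc k) powr q * \<gamma> ^ k)"
    using summable_powr_times_power[OF \<gamma>] .
  have "(\<Sum>v\<in>level G N. \<bar>cutoff_sum M N h v\<bar> powr q * prob (cell v))
      \<le> (\<Sum>v\<in>level G N. (\<Sum>k\<in>?I. if ?in k v then real (Suc k) powr q else 0) * prob (cell v))"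
    using pt by (intro sum_mono mult_right_mono) auto
  also have "\<dots> = (\<Sum>k\<in>?I. \<Sum>v\<in>level G N. if ?in k v then real (Suc k) powr q * prob (cell v) else 0)"
    unfolding sum_distrib_right by (subst sum.swap) (intro sum.cong refl, simp)
  also have "\<dots> \<le> (\<Sum>k\<in>?I. real (Suc k) powr q * (real (L ^ (2 * M)) * (b * \<gamma> ^ k)))"
    using shell by (rule sum_mono)
  also have "\<dots> = real (L ^ (2 * M)) * b * (\<Sum>k\<in>?I. real (Suc k) powr q * \<gamma> ^ k)"
    by (simp add: sum_distrib_left mult_ac del: of_nat_Suc)
  also have "\<dots> \<le> real (L ^ (2 * M)) * b * (\<Sum>k. real (Suc k) powr q * \<gamma> ^ k)"
    using summable fin b \<gamma> by (intro mult_left_mono sum_le_suminf) auto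
  finally show ?thesis .
qed

text \<open>Below the ray vertex of index \<open>k\<close> the ancestors on the earlier levels are
  the ray vertices themselves, so all cutoffs up to \<open>k\<close> are 1 there. The bound is free
  of \<open>N\<close>, and so survives the limit.\<close>

lemma average_cutoff_sum_ge:
  assumes h: "cutoffs G cell M r N h"
    and r: "\<And>n. r n \<in> level G n" "\<And>n. parent G (r (Suc n)) = r n"
    and k: "k * (M + 1) \<le> N"
  shows "(\<Sum>j\<le>k. 1 / real (Suc j)) \<le> average (N - k * (M + 1)) (cutoff_sum M N h) (r (k * (M + 1)))"
proof -
  define n where "n = k * (M + 1)"
  define m where "m = N - n"
  have N: "N = n + m" using k by (simp add: n_def m_def)
  let ?H = "\<Sum>j\<le>k. 1 / real (Suc j)"
  have ge: "?H \<le> cutoff_sum M N h v" if v: "v \<in> descendants G m (r n)" for v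
  proof -
    have vl: "v \<in> level G N" "(parent G ^^ m) v = r n"
      using v by (auto simp: descendants_eq[OF r(1)] N)
    have one: "h j v = 1" if j: "j \<le> k" for j
    proof -
      define i where "i = (k - j) * (M + 1)"
      have n: "n = j * (M + 1) + i" using j by (simp add: n_def i_def flip: add_mult_distrib)
      have "(parent G ^^ (N - j * (M + 1))) v = (parent G ^^ i) ((parent G ^^ m) v)"
        using N n by (simp flip: funpow_add[THEN fun_cong, unfolded o_apply])
      also have "\<dots> = r (j * (M + 1))"
        using ray_ancestor[of r i "j * (M + 1)"] r(2) vl n by simp
      finally show ?thesis
        using h vl(1) N n neighborhood_self[OF level_verts[OF r(1)]] unfolding cutoffs_def
        by (metis le_add1 le_trans)
    qed
    have "?H = (\<Sum>j\<le>k. 1 / real (Suc j) * h j v)" using one by (intro sum.cong) auto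
    also have "\<dots> \<le> cutoff_sum M N h v"
      unfolding cutoff_sum_def
    proof (rule sum_mono2)
      show "{..k} \<subseteq> {k. k * (M + 1) \<le> N}"
        using k mult_le_mono1[of _ k "M + 1"] le_trans by blast
      show "0 \<le> 1 / real (Suc j) * h j v" if "j \<in> {k. k * (M + 1) \<le> N} - {..k}" for j
        using h that vl(1) unfolding cutoffs_def by simp
    qed simp
    finally show ?thesis .
  qed
  have P: "0 < prob (cell (r n))" using prob_cell_pos level_verts r(1) by blast
  have "?H * prob (cell (r n)) = (\<Sum>v\<in>descendants G m (r n). ?H * prob (cell v))"
    using prob_descendants[OF r(1), of n m] by (simp add: sum_distrib_left)
  also have "\<dots> \<le> (\<Sum>v\<in>descendants G m (r n). cutoff_sum M N h v * prob (cell v))"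
    using ge by (intro sum_mono mult_right_mono) auto
  finally show ?thesis
    using P by (simp add: average_def n_def m_def field_simps)
qed

theorem unbounded_function_exists:
  assumes K: "compact K"
    and M: "\<And>w. w \<in> verts G \<Longrightarrow>
      parent G ` neighborhood G cell (M + 1) w \<subseteq> neighborhood G cell M (parent G w)"
    and mass: "\<And>w. w \<in> verts G \<Longrightarrow> prob (cell w) \<le> b * \<gamma> ^ depth G w" "0 \<le> b" "0 < \<gamma>" "\<gamma> < 1"
    and covering: "covering_system G cell N\<^sub>T N \<I>"
    and p: "1 < p" and c: "0 < c" and \<sigma>: "0 < \<sigma>" "\<sigma> \<le> 1"
    and cond: "\<And>m w. w \<in> verts G \<Longrightarrow> conductance G cell p m (depth G w) {w}
      (level G (depth G w) - neighborhood G cell M w) \<le> c * \<sigma> powi (- int m)"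
    and disp: "\<And>m n. 1 \<le> n \<Longrightarrow> neighbor_disparity_const G cell \<mu> \<I> p m n \<le> ennreal (c * \<sigma> ^ m)"
  shows "\<exists>f. in_Lp p \<mu> f \<and> \<not> ess_bounded \<mu> f \<and> \<not> ae_continuous K \<mu> f \<and>
    (SUP n\<in>{1..}. ennreal (\<sigma> ^ n * energy cell p (level G n) (cell_average \<mu> cell f))) < \<infinity>"
proof -
  obtain r where r: "\<And>n. r n \<in> level G n" "\<And>n. parent G (r (Suc n)) = r n"
    using ray_exists by blast
  have p0: "0 \<le> p" using p by simp
  define B where "B = real (L ^ M) powr p * real (L ^ M) * (2 * c)"
  have B: "0 \<le> B" using c by (simp add: B_def)
  obtain h where h: "\<And>N. cutoffs G cell M r N (h N)"
    and h_energy: "\<And>N k. k * (M + 1) \<le> N \<Longrightarrow>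
      \<sigma> ^ N * energy cell p (level G N) (h N k) \<le> B * \<sigma> ^ (k * (M + 1))"
    using cutoffs_exist[where r = r and M = M, OF r(1) p0 c \<sigma>(1) cond] unfolding B_def by blast
  define F where "F N = cutoff_sum M N (h N)" for N
  define Z where "Z = (\<Sum>k. (1 / real (Suc k)) powr p)"
  have summable_Z: "summable (\<lambda>k. (1 / real (Suc k)) powr p)"
  proof -
    have "summable (\<lambda>k. real (Suc k) powr - p)"
      using p summable_real_powr_iff[of "- p"] by (subst summable_Suc_iff) simp
    then show ?thesis by (simp add: powr_divide powr_minus_divide del: of_nat_Suc)
  qed
  have F_energy: "\<sigma> ^ N * energy cell p (level G N) (F N) \<le> B * Z" for N
  proof -
    have "\<sigma> ^ N * energy cell p (level G N) (F N)
        \<le> \<sigma> ^ N * (\<Sum>k | k * (M + 1) \<le> N. (1 / real (Suc k)) powr p * energy cell p (level G N) (h N k))"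
      unfolding F_def using \<sigma> by (intro mult_left_mono energy_cutoff_sum_le[OF h r M p0]) auto
    also have "\<dots> = (\<Sum>k | k * (M + 1) \<le> N.
        (1 / real (Suc k)) powr p * (\<sigma> ^ N * energy cell p (level G N) (h N k)))"
      by (simp only: sum_distrib_left mult_ac)
    also have "\<dots> \<le> (\<Sum>k | k * (M + 1) \<le> N. (1 / real (Suc k)) powr p * B)"
    proof (intro sum_mono mult_left_mono)
      fix k assume "k \<in> {k. k * (M + 1) \<le> N}"
      then have "\<sigma> ^ N * energy cell p (level G N) (h N k) \<le> B * \<sigma> ^ (k * (M + 1))"
        using h_energy by blast
      \<comment> \<open>Here \<sigma> \<le> 1 enters: cutoffs of all levels have normalised energy
        at most \<open>B\<close>.\<close>
      also have "\<dots> \<le> B * 1" using B \<sigma> by (intro mult_left_mono power_le_one) auto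
      finally show "\<sigma> ^ N * energy cell p (level G N) (h N k) \<le> B" by simp
    qed simp
    also have "\<dots> = B * (\<Sum>k | k * (M + 1) \<le> N. (1 / real (Suc k)) powr p)"
      by (simp add: sum_distrib_left mult.commute del: of_nat_Suc)
    also have "\<dots> \<le> B * Z"
      unfolding Z_def using B by (intro mult_left_mono sum_le_suminf summable_Z) auto
    finally show ?thesis .
  qed
  \<comment> \<open>Three exponents are used: 1 bounds the averages at each vertex before the
    diagonal extraction, 2 gives convergence of the limit martingale, and \<open>p\<close> gives
    membership in the required space.\<close>
  define Q where "Q q = real (L ^ (2 * M)) * b * (\<Sum>k. real (Suc k) powr q * \<gamma> ^ k)" for q
  have F_moments: "(\<Sum>v\<in>level G N. \<bar>F N v\<bar> powr q * prob (cell v)) \<le> Q q" if "1 \<le> q" for N q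
    unfolding F_def Q_def by (rule moments_cutoff_sum_le[OF h r(1) that mass])
  \<comment> \<open>The default 0 concerns only the finitely many \<open>N\<close> below the depth
    of \<open>v\<close>, hence not the limit.\<close>
  define A where "A N v = (if depth G v \<le> N then average (N - depth G v) (F N) v else 0)" for N v
  have A_level: "A (n + m) v = average m (F (n + m)) v" if "v \<in> level G n" for n m v
    using level_depth[OF that] by (simp add: A_def)
  have A_moments: "(\<Sum>v\<in>level G n. \<bar>A N v\<bar> powr q * prob (cell v)) \<le> Q q"
    if "1 \<le> q" "n \<le> N" for n N q
  proof -
    define m where "m = N - n"
    have N: "N = n + m" using that by (simp add: m_def)
    have "(\<Sum>v\<in>level G n. \<bar>A N v\<bar> powr q * prob (cell v))
        = (\<Sum>v\<in>level G n. \<bar>average m (F N) v\<bar> powr q * prob (cell v))"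
      unfolding N by (intro sum.cong) (simp_all add: A_level)
    also have "\<dots> \<le> (\<Sum>v\<in>level G N. \<bar>F N v\<bar> powr q * prob (cell v))"
      unfolding N by (rule sum_average_powr_le[OF that(1)])
    also have "\<dots> \<le> Q q" by (rule F_moments[OF that(1)])
    finally show ?thesis .
  qed
  have "\<exists>B. \<forall>N. \<bar>A N v\<bar> \<le> B" if v: "v \<in> verts G" for v
  proof (intro exI allI)
    fix N
    have P: "0 < prob (cell v)" using prob_cell_pos[OF v] .
    have "\<bar>A N v\<bar> * prob (cell v) \<le> max 0 (Q 1)"
    proof (cases "depth G v \<le> N")
      case True
      have "\<bar>A N v\<bar> powr 1 * prob (cell v) \<le> (\<Sum>v\<in>level G (depth G v). \<bar>A N v\<bar> powr 1 * prob (cell v))"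
        using in_level_depth[OF v] finite_level by (intro member_le_sum) auto
      also have "\<dots> \<le> Q 1" using True by (intro A_moments) auto
      finally show ?thesis by simp
    qed (simp add: A_def)
    then show "\<bar>A N v\<bar> \<le> max 0 (Q 1) / prob (cell v)"
      using P by (simp add: field_simps)
  qed
  moreover have "countable (verts G)" using infinite_tree by (simp add: infinite_tree_def)
  ultimately obtain d where d: "strict_mono d"
    and conv: "\<And>v. v \<in> verts G \<Longrightarrow> convergent (\<lambda>i. A (d i) v)"
    using diagonal_convergent[of "verts G" A] by blast
  define a where "a v = lim (\<lambda>i. A (d i) v)" for v
  have a: "(\<lambda>i. A (d i) v) \<longlonglongrightarrow> a v" if "v \<in> verts G" for v
    using conv[OF that] by (simp add: a_def convergent_LIMSEQ_iff)
  have ev: "eventually (\<lambda>i. n \<le> d i) sequentially" for n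
    using filterlim_subseq[OF d] by (simp add: filterlim_at_top)
  have a_mart: "a w * prob (cell w) = (\<Sum>v\<in>children G w. a v * prob (cell v))"
    if w: "w \<in> verts G" for w
  proof (rule LIMSEQ_unique)
    show "(\<lambda>i. A (d i) w * prob (cell w)) \<longlonglongrightarrow> a w * prob (cell w)"
      by (intro tendsto_intros a w)
    define n where "n = depth G w"
    have wl: "w \<in> level G n" using in_level_depth[OF w] by (simp add: n_def)
    have "(\<lambda>i. \<Sum>v\<in>children G w. A (d i) v * prob (cell v)) \<longlonglongrightarrow> (\<Sum>v\<in>children G w. a v * prob (cell v))"
      by (intro tendsto_intros a) (simp add: children_def)
    \<comment> \<open>The identity holds once the level of the children is at most
      \<open>d i\<close>, so that neither side takes the default 0.\<close>
    moreover have "eventually (\<lambda>i. (\<Sum>v\<in>children G w. A (d i) v * prob (cell v)) = A (d i) w * prob (cell w))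
        sequentially"
      using ev[of "Suc n"]
    proof eventually_elim
      fix i assume "Suc n \<le> d i"
      then obtain m where m: "d i = Suc n + m" using le_Suc_ex by blast
      have "A (d i) w = average (Suc m) (F (d i)) w"
        using A_level[OF wl, of "Suc m"] m by simp
      moreover have "A (d i) v = average m (F (d i)) v" if "v \<in> children G w" for v
        using A_level[of v "Suc n" m] that m by (simp add: children_eq[OF wl])
      ultimately show "(\<Sum>v\<in>children G w. A (d i) v * prob (cell v)) = A (d i) w * prob (cell w)"
        by (simp add: average_children[OF wl])
    qed
    ultimately show "(\<lambda>i. A (d i) w * prob (cell w)) \<longlonglongrightarrow> (\<Sum>v\<in>children G w. a v * prob (cell v))"
      by (rule Lim_transform_eventually)
  qed
  have a_moments: "(\<Sum>v\<in>level G n. \<bar>a v\<bar> powr q * prob (cell v)) \<le> Q q" if q: "1 \<le> q" for n q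
  proof (rule tendsto_upperbound)
    show "(\<lambda>i. \<Sum>v\<in>level G n. \<bar>A (d i) v\<bar> powr q * prob (cell v))
        \<longlonglongrightarrow> (\<Sum>v\<in>level G n. \<bar>a v\<bar> powr q * prob (cell v))"
      using q by (intro tendsto_sum tendsto_mult tendsto_powr' tendsto_rabs a tendsto_const level_verts) auto
    show "eventually (\<lambda>i. (\<Sum>v\<in>level G n. \<bar>A (d i) v\<bar> powr q * prob (cell v)) \<le> Q q) sequentially"
      using ev[of n] by eventually_elim (rule A_moments[OF q])
  qed simp
  define E where "E = real N powr p * real N * real L ^ (N + 1) * real N\<^sub>T * c * (B * Z)"
  have a_energy: "\<sigma> ^ n * energy cell p (level G n) a \<le> E" if n: "1 \<le> n" for n
  proof (rule tendsto_upperbound)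
    show "(\<lambda>i. \<sigma> ^ n * energy cell p (level G n) (A (d i))) \<longlonglongrightarrow> \<sigma> ^ n * energy cell p (level G n) a"
      using p by (intro tendsto_mult tendsto_const tendsto_energy a level_verts) auto
    show "eventually (\<lambda>i. \<sigma> ^ n * energy cell p (level G n) (A (d i)) \<le> E) sequentially"
      using ev[of n]
    proof eventually_elim
      fix i assume "n \<le> d i"
      then obtain m where m: "d i = n + m" using le_Suc_ex by blast
      let ?C = "real N powr p * real N * real L ^ (N + 1) * real N\<^sub>T"
      have "\<sigma> ^ n * energy cell p (level G n) (A (d i))
          = \<sigma> ^ n * energy cell p (level G n) (average m (F (n + m)))"
        unfolding m by (intro arg_cong2[of _ _ _ _ "(*)"] refl energy_cong A_level)
      also have "\<dots> \<le> \<sigma> ^ n * (?C * (c * \<sigma> ^ m) * energy cell p (level G (n + m)) (F (n + m)))"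
        using c \<sigma> by (intro mult_left_mono energy_average_le[OF covering p0 n _ disp[OF n]]) auto
      \<comment> \<open>The disparity factor \<sigma>^m and the normalisation \<sigma>^n combine to
        the normalisation of level \<open>n + m\<close>, so the bound depends neither on
        \<open>n\<close> nor on \<open>i\<close>.\<close>
      also have "\<dots> = ?C * c * (\<sigma> ^ (n + m) * energy cell p (level G (n + m)) (F (n + m)))"
        by (simp add: power_add mult_ac)
      also have "\<dots> \<le> ?C * c * (B * Z)"
        using c by (intro mult_left_mono F_energy) auto
      finally show "\<sigma> ^ n * energy cell p (level G n) (A (d i)) \<le> E" unfolding E_def .
    qed
  qed simp
  have a_ge: "(\<Sum>j\<le>k. 1 / real (Suc j)) \<le> a (r (k * (M + 1)))" for k
  proof (rule tendsto_lowerbound)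
    let ?n = "k * (M + 1)"
    show "(\<lambda>i. A (d i) (r ?n)) \<longlonglongrightarrow> a (r ?n)" using a level_verts r(1) by blast
    show "eventually (\<lambda>i. (\<Sum>j\<le>k. 1 / real (Suc j)) \<le> A (d i) (r ?n)) sequentially"
      using ev[of ?n]
    proof eventually_elim
      fix i assume "?n \<le> d i"
      then show "(\<Sum>j\<le>k. 1 / real (Suc j)) \<le> A (d i) (r ?n)"
        using average_cutoff_sum_ge[OF h r] level_depth[OF r(1), of ?n] by (simp only: A_def F_def if_True)
    qed
  qed simp
  have a_square: "(\<Sum>v\<in>level G n. (a v)\<^sup>2 * prob (cell v)) \<le> Q 2" for n
    using a_moments[of 2 n] by simp
  obtain f s where f: "integrable \<mu> f"
    and f_lim: "AE x in \<mu>. (\<lambda>i. step (s i) a x) \<longlonglongrightarrow> f x"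
    and f_avg: "\<And>w. w \<in> verts G \<Longrightarrow> cell_average \<mu> cell f w = a w"
    using martingale_limit[OF a_mart a_square] by blast
  have Lp: "in_Lp p \<mu> f"
    using p a_moments[of p] by (intro in_Lp_step_limit[OF _ borel_measurable_integrable[OF f] f_lim]) auto
  have not_bounded: "\<not> ess_bounded \<mu> f"
  proof
    assume "ess_bounded \<mu> f"
    then obtain C where C: "AE x in \<mu>. \<bar>f x\<bar> \<le> C" by (auto simp: ess_bounded_def)
    have a_le: "a w \<le> C" if w: "w \<in> verts G" for w
    proof -
      have [measurable]: "cell w \<in> sets \<mu>" using w by simp
      have "(LINT x:cell w|\<mu>. f x) \<le> (LINT x:cell w|\<mu>. C)"
        unfolding set_lebesgue_integral_def
      proof (rule integral_mono_AE)
        show "integrable \<mu> (\<lambda>x. indicator (cell w) x *\<^sub>R f x)"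
          using f by (intro integrable_mult_indicator) auto
        show "AE x in \<mu>. indicator (cell w) x *\<^sub>R f x \<le> indicator (cell w) x *\<^sub>R C"
          using C by eventually_elim (auto simp: indicator_def)
      qed (intro integrable_mult_indicator; simp)
      also have "\<dots> = C * prob (cell w)"
        by (simp add: set_integral_const)
      finally show ?thesis
        using f_avg[OF w] prob_cell_pos[OF w] by (simp add: cell_average_def field_simps)
    qed
    \<comment> \<open>An essential bound for \<open>f\<close> bounds all its cell averages, and
      along the ray these dominate the partial sums of the harmonic series.\<close>
    have "summable (\<lambda>j. 1 / real (Suc j))"
    proof (rule summableI_nonneg_bounded)
      fix k
      have "(\<Sum>j<k. 1 / real (Suc j)) \<le> (\<Sum>j\<le>k. 1 / real (Suc j))"
        by (intro sum_mono2) auto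
      also have "\<dots> \<le> C" using a_ge[of k] a_le level_verts r(1) order.trans by blast
      finally show "(\<Sum>j<k. 1 / real (Suc j)) \<le> C" .
    qed simp
    then show False
      using not_summable_harmonic[where 'a = real] summable_Suc_iff[of "\<lambda>n. 1 / real n"]
      by (simp add: inverse_eq_divide)
  qed
  have "\<not> ae_continuous K \<mu> f"
  proof
    assume "ae_continuous K \<mu> f"
    then obtain g where g: "continuous_on K g" "AE x in \<mu>. f x = g x"
      by (auto simp: ae_continuous_def)
    have "bounded (g ` K)" using compact_continuous_image[OF g(1) K] by (rule compact_imp_bounded)
    then obtain C where C: "\<And>x. x \<in> K \<Longrightarrow> \<bar>g x\<bar> \<le> C" by (auto simp: bounded_iff)
    have "AE x in \<mu>. \<bar>f x\<bar> \<le> C"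
      using g(2) AE_space by eventually_elim (use C in \<open>auto simp: space_eq\<close>)
    then show False using not_bounded by (auto simp: ess_bounded_def)
  qed
  moreover have "(SUP n\<in>{1..}. ennreal (\<sigma> ^ n * energy cell p (level G n) (cell_average \<mu> cell f))) < \<infinity>"
  proof (rule le_less_trans)
    show "(SUP n\<in>{1..}. ennreal (\<sigma> ^ n * energy cell p (level G n) (cell_average \<mu> cell f))) \<le> ennreal E"
    proof (rule SUP_least)
      fix n :: nat assume "n \<in> {1..}"
      moreover have "energy cell p (level G n) (cell_average \<mu> cell f) = energy cell p (level G n) a"
        by (intro energy_cong f_avg level_verts)
      ultimately show "ennreal (\<sigma> ^ n * energy cell p (level G n) (cell_average \<mu> cell f)) \<le> ennreal E"
        using a_energy[of n] by (simp add: ennreal_leI)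
    qed
  qed simp
  ultimately show ?thesis using Lp not_bounded by blast
qed

end

theorem theorem2p7:
  fixes G :: "'t rooted_graph"
    and K :: "'a::metric_space set"
    and cell :: "'t \<Rightarrow> 'a set"
    and \<mu> :: "'a measure"
    and M N\<^sub>T N\<^sub>E :: nat
    and \<I> :: "'t set set"
    and p c \<sigma> :: real
  assumes tree: "infinite_tree G" "locally_finite_graph G" "leafless G"
    and K: "compact K" "connected K" "diameter K = 1"
    and partition: "tree_partition G K cell"
    and bounded_overlap:
      "\<exists>L>0. \<forall>n. \<forall>w\<in>level G n.
         finite {v \<in> level G n - {w}. cell w \<inter> cell v \<noteq> {}} \<and>
         real (card {v \<in> level G n - {w}. cell w \<inter> cell v \<noteq> {}}) \<le> L"
    and M: "M \<ge> 1"
      "\<forall>w\<in>verts G. parent G ` neighborhood G cell (M + 1) w \<subseteq> neighborhood G cell M (parent G w)"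
    and measure: "prob_space \<mu>" "borel_regular_on K \<mu>"
      "\<forall>w\<in>verts G. 0 < measure \<mu> (cell w) \<and>
         measure \<mu> (cell w) = (\<Sum>v\<in>children G w. measure \<mu> (cell v))"
      "\<exists>c\<^sub>\<mu>>0. \<exists>\<gamma>. 0 < \<gamma> \<and> \<gamma> < 1 \<and> (\<forall>w\<in>verts G. measure \<mu> (cell w) \<le> c\<^sub>\<mu> * \<gamma> ^ depth G w)"
    and covering: "covering_system G cell N\<^sub>T N\<^sub>E \<I>"
    and p: "1 < p"
    and constants: "0 < c" "0 < \<sigma>" "\<sigma> \<le> 1"
    and conductance_bound:
      "\<forall>m. \<forall>w\<in>verts G.
         conductance G cell p m (depth G w) {w}
           (level G (depth G w) - neighborhood G cell M w) \<le> c * \<sigma> powi (- int m)"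
    and disparity_bound:
      "\<forall>m. \<forall>n\<ge>1. neighbor_disparity_const G cell \<mu> \<I> p m n \<le> ennreal (c * \<sigma> ^ m)"
  shows "\<exists>f :: 'a \<Rightarrow> real.
      in_Lp p \<mu> f \<and> \<not> ess_bounded \<mu> f \<and> \<not> ae_continuous K \<mu> f \<and>
      (SUP n\<in>{1..}. ennreal (\<sigma> ^ n * energy cell p (level G n) (cell_average \<mu> cell f))) < \<infinity>"
proof -
  interpret rooted_tree G by unfold_locales (fact tree)+
  obtain L' :: real where L': "\<And>n w. w \<in> level G n \<Longrightarrow>
      finite {v \<in> level G n - {w}. touching cell w v} \<and>
      real (card {v \<in> level G n - {w}. touching cell w v}) \<le> L'"
    using bounded_overlap by blast
  \<comment> \<open>The successor accounts for \<open>w\<close> itself, which the assumption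
    excludes from the count; the ceiling turns the real bound into a natural number.\<close>
  define L where "L = Suc (nat \<lceil>L'\<rceil>)"
  have "card {v \<in> level G n. touching cell w v} \<le> L" if w: "w \<in> level G n" for n w
  proof -
    have "card {v \<in> level G n. touching cell w v} \<le> card (insert w {v \<in> level G n - {w}. touching cell w v})"
      using L'[OF w] by (intro card_mono) auto
    also have "\<dots> \<le> Suc (card {v \<in> level G n - {w}. touching cell w v})"
      by (rule card_insert_le_m1) simp_all
    also have "\<dots> \<le> L" using L'[OF w] unfolding L_def by (simp add: nat_le_real_less) linarith
    finally show ?thesis .
  qed
  then interpret tree_cells G K cell L
    using partition by unfold_locales
  interpret prob_space \<mu> by (fact measure)
  interpret measured_tree G K cell L \<mu>
    using measure(2,3) by unfold_locales blast+
  obtain c\<^sub>\<mu> \<gamma> where mass: "0 < c\<^sub>\<mu>" "0 < \<gamma>" "\<gamma> < 1"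
    "\<And>w. w \<in> verts G \<Longrightarrow> prob (cell w) \<le> c\<^sub>\<mu> * \<gamma> ^ depth G w"
    using measure(4) by blast
  show ?thesis
  proof (rule unbounded_function_exists[where b = c\<^sub>\<mu> and \<gamma> = \<gamma>, OF K(1) _ mass(4) _ mass(2,3) covering p constants])
    show "parent G ` neighborhood G cell (M + 1) w \<subseteq> neighborhood G cell M (parent G w)"
      if "w \<in> verts G" for w using bspec[OF M(2) that] .
  qed (use mass(1) conductance_bound disparity_bound in auto)
qed

end
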